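(* Let $N\geq3$. There is no hierarchical relationship between non-signalling $N$-time quantum processes on the one hand and classical memory or separable $N$-time quantum processes on the other: $\mathtt{CM}\not\subseteq\mathtt{NS}$, $\mathtt{SEP}\not\subseteq\mathtt{NS}$, $\mathtt{NS}\not\subseteq\mathtt{SEP}$ and $\mathtt{NS}\not\subseteq\mathtt{CM}$.
   Context: All Hilbert spaces are complex, nonzero and finite-dimensional; $\mathcal{L}(\mathcal{H})$ denotes the linear operators on $\mathcal{H}$; $\mathbb{1}_X$ is the identity operator on $\mathcal{H}_X$ and $d_X=\dim\mathcal{H}_X$. Tensor factors are labelled, and operators are identified up to reordering of labelled factors. Choi operators. A linear map $\mathcal{K}:\mathcal{L}(\mathcal{H}_{a})\to\mathcal{L}(\mathcal{H}_{b})$ is represented by $\mathsf{K}=\sum_{ij}|i\rangle\langle j|\otimes\mathcal{K}(|i\rangle\langle j|)\in\mathcal{L}(\mathcal{H}_a\otimes\mathcal{H}_b)$ (computational basis). The Choi operator of the trace map on $\mathcal{H}_a$ is $\mathbb{1}_a$. Link product. For $\mathsf{A}_{12}\in\mathcal{L}(\mathcal{H}_1\otimes\mathcal{H}_2)$ and $\mathsf{B}_{23}\in\mathcal{L}(\mathcal{H}_2\otimes\mathcal{H}_3)$, $\mathsf{A}_{12}\star\mathsf{B}_{23}:=\mathrm{tr}_2[(\mathsf{A}_{12}^{\mathrm{T}_2}\otimes\mathbb{1}_3)(\mathbb{1}_1\otimes\mathsf{B}_{23})]$, with $\mathrm{T}_2$ the partial transpose on $\mathcal{H}_2$ (contract over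 shared spaces, tensor product on the others). $\bigstar_j$ denotes an iterated link product. Spaces. At each time $t_j$, $j=1,\dots,N-1$, the system has two spaces $\mathcal{H}_{S_{j^{\mathtt{i}}}}$ and $\mathcal{H}_{S_{j^{\mathtt{o}}}}$; at $t_N$ it has only $\mathcal{H}_{S_{N^{\mathtt{i}}}}$. $N$-time processes are operators in $\mathcal{L}(\mathcal{H}_{S_{N^{\mathtt{i}}}}\otimes\bigotimes_{j=1}^{N-1}\mathcal{H}_{S_{j^{\mathtt{o}}}}\otimes\mathcal{H}_{S_{j^{\mathtt{i}}}})$. Below, $j^{\mathtt{i}}$, $j^{\mathtt{o}}$ without $S$ refer to the system spaces. The environment has arbitrary finite-dimensional spaces $\mathcal{H}_{E_{j^{\mathtt{i}}}}$, $\mathcal{H}_{E_{j^{\mathtt{o}}}}$ ($j\le N-1$) and $\mathcal{H}_{E_{N^{\mathtt{i}}}}$, not fixed in advance. Convention. For given $N$, each set below consists of all such operators, for all choices of finite-dimensional system spaces. Thus $A\not\subseteq B$ means: for some choice of system spaces there is an element of $A$ not in $B$. Consider operators of the form $$\mathbb{1}_{E_{N^{\mathtt{i}}}}\star\Big(\bigstar_{j=1}^{N-1}\mathsf{U}_{(ES)_{j+1^{\mathtt{i}}j^{\mathtt{o}}}}\star\mathsf{X}_{E_j}\Big)\star\rho_{(ES)_{1^{\mathtt{i}}}}\qquad(\ast)$$ with $\rho_{(ES)_{1^{\mathtt{i}}}}$ a density operator on $\mathcal{H}_{E_{1^{\mathtt{i}}}}\otimes\mathcal{H}_{S_{1^{\mathtt{i}}}}$,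 each $\mathsf{U}_{(ES)_{j+1^{\mathtt{i}}j^{\mathtt{o}}}}$ the Choi operator of a unitary channel $\mathcal{L}(\mathcal{H}_{E_{j^{\mathtt{o}}}}\otimes\mathcal{H}_{S_{j^{\mathtt{o}}}})\to\mathcal{L}(\mathcal{H}_{E_{j+1^{\mathtt{i}}}}\otimes\mathcal{H}_{S_{j+1^{\mathtt{i}}}})$, and each $\mathsf{X}_{E_j}\in\mathcal{L}(\mathcal{H}_{E_{j^{\mathtt{o}}}}\otimes\mathcal{H}_{E_{j^{\mathtt{i}}}})$ the Choi operator of a channel from $E_{j^{\mathtt{i}}}$ to $E_{j^{\mathtt{o}}}$. - $\mathtt{QM}$ (quantum processes): operators of the form $(\ast)$ with each $\mathsf{X}_{E_j}$ the Choi operator of the identity map. By a standard fact, equivalently: operators $\mathsf{C}_{N:1}\geq0$ for which there are $\mathsf{C}_{k:1}\geq0$ ($1\le k\le N-1$) with $\mathrm{tr}_{k^{\mathtt{i}}}[\mathsf{C}_{k:1}]=\mathbb{1}_{k-1^{\mathtt{o}}}\otimes\mathsf{C}_{k-1:1}$ for $k=N,\dots,2$ and $\mathrm{tr}_{1^{\mathtt{i}}}[\mathsf{C}_{1:1}]=1$. - $\mathtt{CM}$ (classical memory): operators of the form $(\ast)$ with each $\mathsf{X}_{E_j}=\sum_x\sigma^{(x)}_{E_{j^{\mathtt{o}}}}\otimes\mathsf{M}^{(x)}_{E_{j^{\mathtt{i}}}}$ an entanglement-breaking channel (finite sum; $\sigma^{(x)}$ density operators, $\{\mathsf{M}^{(x)}\}_x$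 a POVM). - $\mathtt{SEP}$ (separable): elements of $\mathtt{QM}$ that can be written as $\sum_xp_x\,\mathsf{L}^{(x)}_{N^{\mathtt{i}}:N-1^{\mathtt{o}}}\otimes\dots\otimes\mathsf{L}^{(x)}_{2^{\mathtt{i}}:1^{\mathtt{o}}}\otimes\rho^{(x)}_{1^{\mathtt{i}}}$ (finite sum) with $p_x$ a probability distribution, each $\rho^{(x)}_{1^{\mathtt{i}}}\geq0$ on $\mathcal{H}_{S_{1^{\mathtt{i}}}}$ and each $\mathsf{L}^{(x)}_{j+1^{\mathtt{i}}:j^{\mathtt{o}}}\geq0$ on $\mathcal{H}_{S_{j+1^{\mathtt{i}}}}\otimes\mathcal{H}_{S_{j^{\mathtt{o}}}}$. - $\mathtt{NS}$ (non-signalling): elements $\mathsf{C}_{N:1}$ of $\mathtt{QM}$ satisfying, for all $k=2,\dots,N$, $\mathrm{tr}_{k^{\mathtt{i}}}[\mathsf{C}_{N:1}]=\frac{\mathbb{1}_{k-1^{\mathtt{o}}}}{d_{k-1^{\mathtt{o}}}}\otimes\mathrm{tr}_{k^{\mathtt{i}}\,k-1^{\mathtt{o}}}[\mathsf{C}_{N:1}]$. *)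

theory Defs
  imports Complex_Main "HOL-Library.FuncSet" "HOL-Library.Nonpos_Ints"
begin

section \<open>Operators on labelled tensor products\<close>

text \<open>
  A dimension assignment \<open>d\<close> turns every label \<open>l\<close> into the Hilbert space of dimension \<open>d l\<close>; a set
  \<open>a\<close> of labels stands for the tensor product of the corresponding spaces. Its computational basis is
  indexed by the multi-indices in \<open>idx d a\<close>, so no ordering of the factors is involved. Operators are
  matrices over multi-indices that vanish outside the index set, so that equality of operators is
  equality of functions.
\<close>

type_synonym 'l midx = "'l \<Rightarrow> nat"
type_synonym 'l opr = "'l midx \<Rightarrow> 'l midx \<Rightarrow> complex"

definition idx :: "('l \<Rightarrow> nat) \<Rightarrow> 'l set \<Rightarrow> 'l midx set" where
  "idx d a = (\<Pi>\<^sub>E l\<in>a. {..<d l})"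

text \<open>Linear maps from the space of \<open>a\<close> to the space of \<open>b\<close> (row index in \<open>b\<close>, column index in \<open>a\<close>).\<close>

definition lin :: "('l \<Rightarrow> nat) \<Rightarrow> 'l set \<Rightarrow> 'l set \<Rightarrow> 'l opr set" where
  "lin d a b = {A. \<forall>i j. \<not> (i \<in> idx d b \<and> j \<in> idx d a) \<longrightarrow> A i j = 0}"

abbreviation ops :: "('l \<Rightarrow> nat) \<Rightarrow> 'l set \<Rightarrow> 'l opr set" where
  "ops d a \<equiv> lin d a a"

definition ident :: "('l \<Rightarrow> nat) \<Rightarrow> 'l set \<Rightarrow> 'l opr" where
  "ident d a = (\<lambda>i j. if i = j \<and> i \<in> idx d a then 1 else 0)"

definition mat_unit :: "'l midx \<Rightarrow> 'l midx \<Rightarrow> 'l opr" where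
  "mat_unit m n = (\<lambda>i j. if i = m \<and> j = n then 1 else 0)"

text \<open>The first label set is the space in the middle, over which the index is summed.\<close>

definition mult :: "('l \<Rightarrow> nat) \<Rightarrow> 'l set \<Rightarrow> 'l opr \<Rightarrow> 'l opr \<Rightarrow> 'l opr" where
  "mult d a A B = (\<lambda>i j. \<Sum>k\<in>idx d a. A i k * B k j)"

definition adj :: "'l opr \<Rightarrow> 'l opr" where
  "adj A = (\<lambda>i j. cnj (A j i))"

definition trace :: "('l \<Rightarrow> nat) \<Rightarrow> 'l set \<Rightarrow> 'l opr \<Rightarrow> complex" where
  "trace d a A = (\<Sum>i\<in>idx d a. A i i)"

text \<open>In \<open>tensor\<close> the label sets \<open>a\<close> and \<open>b\<close> are meant to be disjoint; in the next two definitions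
  \<open>s\<close> is meant to be a subset of the label set of \<open>A\<close>.\<close>

definition tensor :: "('l \<Rightarrow> nat) \<Rightarrow> 'l set \<Rightarrow> 'l set \<Rightarrow> 'l opr \<Rightarrow> 'l opr \<Rightarrow> 'l opr" where
  "tensor d a b A B = (\<lambda>i j. if i \<in> idx d (a \<union> b) \<and> j \<in> idx d (a \<union> b)
     then A (restrict i a) (restrict j a) * B (restrict i b) (restrict j b) else 0)"

definition ptrace :: "('l \<Rightarrow> nat) \<Rightarrow> 'l set \<Rightarrow> 'l set \<Rightarrow> 'l opr \<Rightarrow> 'l opr" where
  "ptrace d a s A = (\<lambda>i j. if i \<in> idx d (a - s) \<and> j \<in> idx d (a - s)
     then (\<Sum>k\<in>idx d s. A (override_on i k s) (override_on j k s)) else 0)"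

definition ptranspose :: "'l set \<Rightarrow> 'l opr \<Rightarrow> 'l opr" where
  "ptranspose s A = (\<lambda>i j. A (override_on i j s) (override_on j i s))"

definition psd :: "('l \<Rightarrow> nat) \<Rightarrow> 'l set \<Rightarrow> 'l opr \<Rightarrow> bool" where
  "psd d a A \<longleftrightarrow> A \<in> ops d a \<and>
     (\<forall>v. (\<Sum>i\<in>idx d a. \<Sum>j\<in>idx d a. cnj (v i) * A i j * v j) \<in> \<real>\<^sub>\<ge>\<^sub>0)"

definition density :: "('l \<Rightarrow> nat) \<Rightarrow> 'l set \<Rightarrow> 'l opr \<Rightarrow> bool" where
  "density d a A \<longleftrightarrow> psd d a A \<and> trace d a A = 1"

definition povm :: "('l \<Rightarrow> nat) \<Rightarrow> 'l set \<Rightarrow> nat \<Rightarrow> (nat \<Rightarrow> 'l opr) \<Rightarrow> bool" where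
  "povm d a n M \<longleftrightarrow> (\<forall>x<n. psd d a (M x)) \<and> (\<lambda>i j. \<Sum>x<n. M x i j) = ident d a"

section \<open>Channels, Choi operators and the link product\<close>

definition choi :: "('l \<Rightarrow> nat) \<Rightarrow> 'l set \<Rightarrow> 'l set \<Rightarrow> ('l opr \<Rightarrow> 'l opr) \<Rightarrow> 'l opr" where
  "choi d a b K = (\<lambda>i j. \<Sum>m\<in>idx d a. \<Sum>n\<in>idx d a.
     tensor d a b (mat_unit m n) (K (mat_unit m n)) i j)"

text \<open>The block \<open>\<langle>s|P|t\<rangle>\<close> of an operator \<open>P\<close> on \<open>insert r a\<close>, where \<open>s\<close> and \<open>t\<close> index the basis of
  the ancilla \<open>r\<close>, and the action of \<open>K\<close> tensored with the identity map on the ancilla.\<close>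

definition block :: "('l \<Rightarrow> nat) \<Rightarrow> 'l set \<Rightarrow> 'l \<Rightarrow> 'l opr \<Rightarrow> 'l midx \<Rightarrow> 'l midx \<Rightarrow> 'l opr" where
  "block d a r P s t = (\<lambda>m n. if m \<in> idx d a \<and> n \<in> idx d a
     then P (override_on m s {r}) (override_on n t {r}) else 0)"

definition ampliation ::
  "('l \<Rightarrow> nat) \<Rightarrow> 'l set \<Rightarrow> 'l set \<Rightarrow> 'l \<Rightarrow> ('l opr \<Rightarrow> 'l opr) \<Rightarrow> 'l opr \<Rightarrow> 'l opr" where
  "ampliation d a b r K P = (\<lambda>i j. \<Sum>s\<in>idx d {r}. \<Sum>t\<in>idx d {r}.
     tensor d b {r} (K (block d a r P s t)) (mat_unit s t) i j)"

definition linear_map :: "('l \<Rightarrow> nat) \<Rightarrow> 'l set \<Rightarrow> 'l set \<Rightarrow> ('l opr \<Rightarrow> 'l opr) \<Rightarrow> bool" where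
  "linear_map d a b K \<longleftrightarrow> (\<forall>A\<in>ops d a. K A \<in> ops d b) \<and>
     (\<forall>A\<in>ops d a. \<forall>B\<in>ops d a. K (\<lambda>i j. A i j + B i j) = (\<lambda>i j. K A i j + K B i j)) \<and>
     (\<forall>A\<in>ops d a. \<forall>c. K (\<lambda>i j. c * A i j) = (\<lambda>i j. c * K A i j))"

definition completely_positive ::
  "('l \<Rightarrow> nat) \<Rightarrow> 'l set \<Rightarrow> 'l set \<Rightarrow> ('l opr \<Rightarrow> 'l opr) \<Rightarrow> bool" where
  "completely_positive d a b K \<longleftrightarrow> (\<forall>r n P. r \<notin> a \<union> b \<and> 0 < n \<and> psd (d(r := n)) (insert r a) P \<longrightarrow>
     psd (d(r := n)) (insert r b) (ampliation (d(r := n)) a b r K P))"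

definition channel :: "('l \<Rightarrow> nat) \<Rightarrow> 'l set \<Rightarrow> 'l set \<Rightarrow> ('l opr \<Rightarrow> 'l opr) \<Rightarrow> bool" where
  "channel d a b K \<longleftrightarrow> linear_map d a b K \<and> completely_positive d a b K \<and>
     (\<forall>A\<in>ops d a. trace d b (K A) = trace d a A)"

definition channel_choi :: "('l \<Rightarrow> nat) \<Rightarrow> 'l set \<Rightarrow> 'l set \<Rightarrow> 'l opr \<Rightarrow> bool" where
  "channel_choi d a b X \<longleftrightarrow> (\<exists>K. channel d a b K \<and> X = choi d a b K)"

definition unitary :: "('l \<Rightarrow> nat) \<Rightarrow> 'l set \<Rightarrow> 'l set \<Rightarrow> 'l opr \<Rightarrow> bool" where
  "unitary d a b V \<longleftrightarrow> V \<in> lin d a b \<and>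
     mult d b (adj V) V = ident d a \<and> mult d a V (adj V) = ident d b"

definition unitary_choi :: "('l \<Rightarrow> nat) \<Rightarrow> 'l set \<Rightarrow> 'l set \<Rightarrow> 'l opr \<Rightarrow> bool" where
  "unitary_choi d a b U \<longleftrightarrow> (\<exists>V. unitary d a b V \<and>
     U = choi d a b (\<lambda>A. mult d a (mult d a V A) (adj V)))"

text \<open>The identity map between the spaces of two labels \<open>l\<close> and \<open>l'\<close> of equal dimension.\<close>

definition relabel :: "('l \<Rightarrow> nat) \<Rightarrow> 'l \<Rightarrow> 'l \<Rightarrow> 'l opr \<Rightarrow> 'l opr" where
  "relabel d l l' A = (\<lambda>i j. if i \<in> idx d {l'} \<and> j \<in> idx d {l'}
     then A (\<lambda>_\<in>{l}. i l') (\<lambda>_\<in>{l}. j l') else 0)"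

definition identity_choi :: "('l \<Rightarrow> nat) \<Rightarrow> 'l \<Rightarrow> 'l \<Rightarrow> 'l opr \<Rightarrow> bool" where
  "identity_choi d l l' X \<longleftrightarrow> d l = d l' \<and> X = choi d {l} {l'} (relabel d l l')"

definition entanglement_breaking_choi :: "('l \<Rightarrow> nat) \<Rightarrow> 'l \<Rightarrow> 'l \<Rightarrow> 'l opr \<Rightarrow> bool" where
  "entanglement_breaking_choi d l l' X \<longleftrightarrow> (\<exists>n \<sigma> M. (\<forall>x<n. density d {l'} (\<sigma> x)) \<and> povm d {l} n M \<and>
     X = (\<lambda>i j. \<Sum>x<n. tensor d {l'} {l} (\<sigma> x) (M x) i j))"

text \<open>Operators paired with their label set.\<close>

type_synonym 'l lopr = "'l set \<times> 'l opr"

fun link :: "('l \<Rightarrow> nat) \<Rightarrow> 'l lopr \<Rightarrow> 'l lopr \<Rightarrow> 'l lopr" where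
  "link d (a, A) (b, B) = (a \<union> b - a \<inter> b, ptrace d (a \<union> b) (a \<inter> b) (mult d (a \<union> b)
     (tensor d a (b - a) (ptranspose (a \<inter> b) A) (ident d (b - a)))
     (tensor d (a - b) b (ident d (a - b)) B)))"

fun ltensor :: "('l \<Rightarrow> nat) \<Rightarrow> 'l lopr \<Rightarrow> 'l lopr \<Rightarrow> 'l lopr" where
  "ltensor d (a, A) (b, B) = (a \<union> b, tensor d a b A B)"

section \<open>Multi-time processes\<close>

text \<open>\<open>SI j\<close>, \<open>SO j\<close>, \<open>EI j\<close>, \<open>EO j\<close>: the input and output spaces of system and environment at time
  \<open>j\<close>.\<close>

datatype label = SI nat | SO nat | EI nat | EO nat

definition sys :: "nat \<Rightarrow> label set" where
  "sys N = SI ` {1..N} \<union> SO ` {1..<N}"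

text \<open>
  The general form of a process with environment operations \<open>X\<close>. No label occurs in more than two
  factors, so the link product is associative and commutative here; the factors are linked in order of
  increasing time, starting from the initial state.
\<close>

definition process_form :: "nat \<Rightarrow> (label \<Rightarrow> nat) \<Rightarrow> (nat \<Rightarrow> label opr) \<Rightarrow> label opr \<Rightarrow> bool" where
  "process_form N d X C \<longleftrightarrow> (\<exists>\<rho> U.
     density d {EI 1, SI 1} \<rho> \<and>
     (\<forall>j\<in>{1..<N}. unitary_choi d {EO j, SO j} {EI (j + 1), SI (j + 1)} (U j)) \<and>
     (\<forall>j\<in>{1..<N}. channel_choi d {EI j} {EO j} (X j)) \<and>
     (sys N, C) = link d ({EI N}, ident d {EI N})
       (fold (\<lambda>j R. link d (link d ({EI (j + 1), SI (j + 1), EO j, SO j}, U j) ({EO j, EI j}, X j)) R)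
         [1..<N] ({EI 1, SI 1}, \<rho>)))"

text \<open>
  The sets of processes range over all choices of system spaces: their elements are pairs of a dimension
  assignment and an operator. Only the system dimensions of the assignment matter; the environment
  dimensions are chosen anew by \<open>env_choice\<close>.
\<close>

definition env_choice :: "(label \<Rightarrow> nat) \<Rightarrow> (label \<Rightarrow> nat) \<Rightarrow> bool" where
  "env_choice d d' \<longleftrightarrow> (\<forall>l. 0 < d' l) \<and> (\<forall>j. d' (SI j) = d (SI j) \<and> d' (SO j) = d (SO j))"

definition QM :: "nat \<Rightarrow> ((label \<Rightarrow> nat) \<times> label opr) set" where
  "QM N = {(d, C). \<exists>d' X. env_choice d d' \<and> process_form N d' X C \<and>
     (\<forall>j\<in>{1..<N}. identity_choi d' (EI j) (EO j) (X j))}"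

definition CM :: "nat \<Rightarrow> ((label \<Rightarrow> nat) \<times> label opr) set" where
  "CM N = {(d, C). \<exists>d' X. env_choice d d' \<and> process_form N d' X C \<and>
     (\<forall>j\<in>{1..<N}. entanglement_breaking_choi d' (EI j) (EO j) (X j))}"

definition SEP :: "nat \<Rightarrow> ((label \<Rightarrow> nat) \<times> label opr) set" where
  "SEP N = {(d, C). (d, C) \<in> QM N \<and> (\<exists>(n::nat) p L \<rho>.
     (\<forall>x<n. 0 \<le> p x) \<and> (\<Sum>x<n. p x) = (1::real) \<and>
     (\<forall>x<n. psd d {SI 1} (\<rho> x)) \<and>
     (\<forall>x<n. \<forall>j\<in>{1..<N}. psd d {SI (j + 1), SO j} (L x j)) \<and>
     C = (\<lambda>i k. \<Sum>x<n. of_real (p x) *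
       snd (fold (\<lambda>j. ltensor d ({SI (j + 1), SO j}, L x j)) [1..<N] ({SI 1}, \<rho> x)) i k))}"

definition NS :: "nat \<Rightarrow> ((label \<Rightarrow> nat) \<times> label opr) set" where
  "NS N = {(d, C). (d, C) \<in> QM N \<and> (\<forall>k\<in>{2..N}.
     ptrace d (sys N) {SI k} C =
     tensor d {SO (k - 1)} (sys N - {SI k, SO (k - 1)})
       (\<lambda>i j. ident d {SO (k - 1)} i j / of_nat (d (SO (k - 1))))
       (ptrace d (sys N) {SI k, SO (k - 1)} C))}"

end

(* For a positive semidefinite operator write R = sum_z |z><z|. Link products contract such
   decompositions vector by vector. If the memory after the first time step is entanglement breaking,
   or if the process is separable, then all the vectors z can be taken to be product vectors between
   the first input space and the remaining spaces, so that C(ab, ab) = 0 forces C(aa, bb) = 0 after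
   swapping the first tensor factor. A process without outputs that only distributes a maximally
   entangled state of the first and the last input is trivially non-signalling but violates this.
   Conversely, a bit that enters at the first output and controls a bit flip on the channel from the
   last output to the last input signals over a long time although the memory is classical. *)

theory Submission
  imports Defs
begin

section \<open>Multi-indices and entries of the link product\<close>

text \<open>\<open>CM\<close> and \<open>SEP\<close> quantify over unknown environments and
  decompositions, so excluding an operator from them needs a property that survives every
  contraction. Being a product vector is therefore encoded as a quadratic exchange identity, which
  can be checked term by term in a contraction; a single matrix entry then refutes both memberships.
  The positive memberships need an exact evaluation of an iterated link product. All gates are
  permutations of basis vectors, so at most one term of each contraction survives. One family,
  switched by \<open>ent\<close>, serves both examples, and \<open>cl\<close> switches between
  identity and dephasing memory. For the signalling example both memories must give the same
  operator, since it has to lie in \<open>SEP\<close>, hence in \<open>QM\<close>, as well as in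
  \<open>CM\<close>; they do, because the control bit is discarded at the end, which dephases it
  anyway. \<open>N >= 3\<close> separates \<open>SI 2\<close> from \<open>SI N\<close>. For two
  times the only non-signalling equation already follows from the marginal conditions of a quantum
  process.\<close>

lemma restrict_idx_iff [simp]: "restrict f a \<in> idx d a \<longleftrightarrow> (\<forall>x\<in>a. f x < d x)"
  by (auto simp: idx_def)

lemma idx_less: "i \<in> idx d a \<Longrightarrow> x \<in> a \<Longrightarrow> i x < d x"
  by (auto simp: idx_def)

lemma idx_undefined: "i \<in> idx d a \<Longrightarrow> x \<notin> a \<Longrightarrow> i x = undefined"
  by (auto simp: idx_def)

lemma finite_idx [simp]: "finite a \<Longrightarrow> finite (idx d a)"
  by (auto simp: idx_def intro!: finite_PiE)

lemma idx_ext: "i \<in> idx d a \<Longrightarrow> j \<in> idx d a \<Longrightarrow> (\<And>x. x \<in> a \<Longrightarrow> i x = j x) \<Longrightarrow> i = j"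
  unfolding idx_def by (rule PiE_ext)

lemma idx_empty [simp]: "idx d {} = {\<lambda>_. undefined}"
  by (simp add: idx_def)

lemma sum_idx_singleton: "(\<Sum>k\<in>idx d {l}. f k) = (\<Sum>e<d l. f (\<lambda>_\<in>{l}. e))"
proof (rule sum.reindex_bij_witness[where i="\<lambda>e. \<lambda>_\<in>{l}. e" and j="\<lambda>k. k l"])
  fix k assume k: "k \<in> idx d {l}"
  show "(\<lambda>_\<in>{l}. k l) = k" using k by (intro idx_ext[of _ d "{l}"]) (auto dest: idx_less)
  then show "f (\<lambda>_\<in>{l}. k l) = f k" by simp
qed (auto dest: idx_less)

lemma sum_idx_insert:
  assumes "l \<notin> a"
  shows "(\<Sum>k\<in>idx d (insert l a). f k) = (\<Sum>e<d l. \<Sum>k\<in>idx d a. f (k(l := e)))"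
proof -
  have "(\<Sum>k\<in>idx d (insert l a). f k) = (\<Sum>(e, k)\<in>{..<d l} \<times> idx d a. f (k(l := e)))"
  proof (rule sum.reindex_bij_witness[where i="\<lambda>(e, k). k(l := e)" and j="\<lambda>k. (k l, restrict k a)"])
    fix k assume k: "k \<in> idx d (insert l a)"
    have "(restrict k a)(l := k l) = k"
      using k by (auto simp: fun_eq_iff idx_undefined)
    then show "(case (k l, restrict k a) of (e, k) \<Rightarrow> k(l := e)) = k"
      "(case (k l, restrict k a) of (e, k) \<Rightarrow> f (k(l := e))) = f k" by simp_all
    show "(k l, restrict k a) \<in> {..<d l} \<times> idx d a" using k by (auto dest: idx_less)
  next
    fix p assume "p \<in> {..<d l} \<times> idx d a"
    then obtain e k where p: "p = (e, k)" and e: "e < d l" and k: "k \<in> idx d a" by auto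
    have "restrict (k(l := e)) a = k"
      using k assms by (auto simp: fun_eq_iff idx_undefined)
    then show "((case p of (e, k) \<Rightarrow> k(l := e)) l, restrict (case p of (e, k) \<Rightarrow> k(l := e)) a) = p"
      using p by simp
    show "(case p of (e, k) \<Rightarrow> k(l := e)) \<in> idx d (insert l a)"
      using p e k by (auto simp: idx_def PiE_def extensional_def)
  qed
  then show ?thesis by (simp add: sum.cartesian_product)
qed

text \<open>The index seen by an operand on \<open>a\<close> when the contracted labels
  \<open>c\<close> carry \<open>k\<close> and the open labels carry \<open>i\<close>; the
  restriction returns it to the canonical index set.\<close>

definition merge :: "'l set \<Rightarrow> 'l set \<Rightarrow> 'l midx \<Rightarrow> 'l midx \<Rightarrow> 'l midx" where
  "merge a c i k = restrict (override_on i k c) a"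

lemma merge_idx:
  assumes "i \<in> idx d s" "k \<in> idx d c" "a \<subseteq> s \<union> c"
  shows "merge a c i k \<in> idx d a"
  using assms by (auto simp: merge_def override_on_def dest: idx_less)

text \<open>The identity paddings force the intermediate index of the matrix product to agree with
  \<open>i\<close> on \<open>b - a\<close> and with \<open>j\<close> on \<open>a - b\<close>, so
  only its part \<open>k\<close> on the shared labels is free. The partial transpose moves
  \<open>k\<close> into the row of \<open>A\<close> and the traced index \<open>l\<close> into its
  column, as in \<open>B\<close>.\<close>

lemma link_apply:
  assumes fin: "finite a" "finite b"
  shows "snd (link d (a, A) (b, B)) i j =
    (if i \<in> idx d (a \<union> b - a \<inter> b) \<and> j \<in> idx d (a \<union> b - a \<inter> b)
     then \<Sum>k\<in>idx d (a \<inter> b). \<Sum>l\<in>idx d (a \<inter> b).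
       A (merge a (a \<inter> b) i k) (merge a (a \<inter> b) j l) *
       B (merge b (a \<inter> b) i k) (merge b (a \<inter> b) j l)
     else 0)"
proof (cases "i \<in> idx d (a \<union> b - a \<inter> b) \<and> j \<in> idx d (a \<union> b - a \<inter> b)")
  case True
  then have i: "i \<in> idx d (a \<union> b - a \<inter> b)" and j: "j \<in> idx d (a \<union> b - a \<inter> b)" by auto
  let ?c = "a \<inter> b"
  let ?m = "\<lambda>k. \<lambda>x\<in>a \<union> b. if x \<in> ?c then k x else if x \<in> a then j x else i x"
  have aux: "(\<Sum>m\<in>idx d (a \<union> b).
       tensor d a (b - a) (ptranspose ?c A) (ident d (b - a)) (override_on i l ?c) m *
       tensor d (a - b) b (ident d (a - b)) B m (override_on j l ?c)) =
     (\<Sum>k\<in>idx d ?c. A (merge a ?c i k) (merge a ?c j l) * B (merge b ?c i k) (merge b ?c j l))"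
    (is "sum ?f _ = sum ?g _")
    if l: "l \<in> idx d ?c" for l
  proof -
    have ol: "override_on i l ?c \<in> idx d (a \<union> b)" "override_on j l ?c \<in> idx d (a \<union> b)"
      using i j l by (auto simp: idx_def PiE_def extensional_def override_on_def)
    have mk: "?m k \<in> idx d (a \<union> b)" if "k \<in> idx d ?c" for k
      using that i j by (auto dest: idx_less)
    have "sum ?g (idx d ?c) = sum ?f (?m ` idx d ?c)"
    proof -
      have inj: "inj_on ?m (idx d ?c)"
      proof (rule inj_onI)
        fix k k' assume k: "k \<in> idx d ?c" "k' \<in> idx d ?c" and eq: "?m k = ?m k'"
        show "k = k'"
        proof (rule idx_ext[OF k])
          fix x assume "x \<in> ?c" then show "k x = k' x" using fun_cong[OF eq, of x] by auto
        qed
      qed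
      have "?g k = ?f (?m k)" if k: "k \<in> idx d ?c" for k
      proof -
        have "restrict (override_on i l ?c) (b - a) = restrict (?m k) (b - a)"
          by (auto simp: fun_eq_iff override_on_def)
        moreover have "restrict (override_on i l ?c) (b - a) \<in> idx d (b - a)"
          using i by (auto simp: override_on_def dest: idx_less)
        moreover have "restrict (?m k) (a - b) = restrict (override_on j l ?c) (a - b)"
          by (auto simp: fun_eq_iff override_on_def)
        moreover have "restrict (override_on j l ?c) (a - b) \<in> idx d (a - b)"
          using j by (auto simp: override_on_def dest: idx_less)
        moreover have "override_on (restrict (override_on i l ?c) a) (restrict (?m k) a) ?c = merge a ?c i k"
          "override_on (restrict (?m k) a) (restrict (override_on i l ?c) a) ?c = merge a ?c j l"
          "restrict (?m k) b = merge b ?c i k" "restrict (override_on j l ?c) b = merge b ?c j l"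
          by (auto simp: fun_eq_iff override_on_def merge_def)
        moreover have "a \<union> (b - a) = a \<union> b" "a - b \<union> b = a \<union> b" by auto
        ultimately show ?thesis
          using ol mk[OF k] by (simp add: tensor_def ptranspose_def ident_def)
      qed
      then show ?thesis unfolding sum.reindex[OF inj] o_def by (rule sum.cong[OF refl])
    qed
    also have "\<dots> = sum ?f (idx d (a \<union> b))"
    proof (rule sum.mono_neutral_left)
      show "finite (idx d (a \<union> b))" using fin by simp
      show "?m ` idx d ?c \<subseteq> idx d (a \<union> b)" using mk by auto
      show "\<forall>m\<in>idx d (a \<union> b) - ?m ` idx d ?c. ?f m = 0"
      proof
        fix m assume m: "m \<in> idx d (a \<union> b) - ?m ` idx d ?c"
        show "?f m = 0"
        proof (rule ccontr)
          assume "?f m \<noteq> 0"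
          then have e: "restrict (override_on i l ?c) (b - a) = restrict m (b - a)"
            "restrict m (a - b) = restrict (override_on j l ?c) (a - b)"
            by (auto simp: tensor_def ident_def split: if_splits)
          have "m = ?m (restrict m ?c)"
          proof
            fix x show "m x = ?m (restrict m ?c) x"
              using fun_cong[OF e(1), of x] fun_cong[OF e(2), of x] m
              by (auto simp: idx_undefined override_on_def)
          qed
          moreover have "restrict m ?c \<in> idx d ?c" using m by (auto dest: idx_less)
          ultimately show False using m by blast
        qed
      qed
    qed
    finally show ?thesis by simp
  qed
  have "snd (link d (a, A) (b, B)) i j = (\<Sum>l\<in>idx d ?c. \<Sum>k\<in>idx d ?c.
      A (merge a ?c i k) (merge a ?c j l) * B (merge b ?c i k) (merge b ?c j l))"
    using i j by (simp add: ptrace_def mult_def aux cong: sum.cong)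
  also have "\<dots> = (\<Sum>k\<in>idx d ?c. \<Sum>l\<in>idx d ?c.
      A (merge a ?c i k) (merge a ?c j l) * B (merge b ?c i k) (merge b ?c j l))"
    by (rule sum.swap)
  finally show ?thesis using i j by simp
next
  case False
  then show ?thesis by (auto simp: ptrace_def)
qed

section \<open>Sums of rank-one operators and product vectors\<close>

text \<open>Index sets are arbitrary finite sets here because the factorization below removes one
  index at a time, which leaves the sets of the form \<open>idx d a\<close>.\<close>

definition quad :: "'i set \<Rightarrow> ('i \<Rightarrow> 'i \<Rightarrow> complex) \<Rightarrow> ('i \<Rightarrow> complex) \<Rightarrow> complex" where
  "quad S A v = (\<Sum>i\<in>S. \<Sum>j\<in>S. cnj (v i) * A i j * v j)"

lemma quad_insert:
  assumes "finite S" "s \<notin> S"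
  shows "quad (insert s S) A v = cnj (v s) * A s s * v s + cnj (v s) * (\<Sum>j\<in>S. A s j * v j)
    + (\<Sum>i\<in>S. cnj (v i) * A i s) * v s + quad S A v"
  using assms by (simp add: quad_def sum.distrib sum_distrib_left sum_distrib_right mult.assoc algebra_simps)

lemma quad_two_points:
  assumes "finite S" "s \<in> S" "t \<in> S" "s \<noteq> t"
  shows "quad S A (\<lambda>k. if k = s then x else if k = t then y else 0) =
    cnj x * A s s * x + cnj x * A s t * y + cnj y * A t s * x + cnj y * A t t * y"
proof -
  define v where "v = (\<lambda>k. if k = s then x else if k = t then y else 0)"
  have "quad S A v = (\<Sum>i\<in>{s, t}. \<Sum>j\<in>{s, t}. cnj (v i) * A i j * v j)"
    unfolding quad_def
  proof (rule sum.mono_neutral_cong_right)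
    show "(\<Sum>j\<in>S. cnj (v i) * A i j * v j) = (\<Sum>j\<in>{s, t}. cnj (v i) * A i j * v j)" for i
      by (rule sum.mono_neutral_right) (use assms in \<open>auto simp: v_def\<close>)
    show "\<forall>i\<in>S - {s, t}. (\<Sum>j\<in>S. cnj (v i) * A i j * v j) = 0"
      by (simp add: v_def)
  qed (use assms in auto)
  also have "\<dots> = cnj x * A s s * x + cnj x * A s t * y + cnj y * A t s * x + cnj y * A t t * y"
    using assms by (simp add: v_def)
  finally show ?thesis by (simp add: v_def)
qed

section \<open>Diagonal, symmetry and zero rows of positive semidefinite matrices\<close>

context
  fixes S :: "'i set" and A :: "'i \<Rightarrow> 'i \<Rightarrow> complex"
  assumes fin: "finite S" and pos: "\<And>v. quad S A v \<in> \<real>\<^sub>\<ge>\<^sub>0"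
begin

lemma pos_diag: assumes "s \<in> S" shows "A s s \<in> \<real>\<^sub>\<ge>\<^sub>0"
proof -
  have "quad S A (\<lambda>k. if k = s then 1 else 0) = A s s"
  proof -
    have "quad S A (\<lambda>k. if k = s then 1 else 0) = (\<Sum>i\<in>S. if i = s then \<Sum>j\<in>S. if j = s then A s s else 0 else 0)"
      unfolding quad_def by (intro sum.cong refl) (auto intro!: sum.cong)
    then show ?thesis using assms fin by simp
  qed
  then show ?thesis using pos by metis
qed

lemma pos_hermitian: assumes "s \<in> S" "t \<in> S" shows "A s t = cnj (A t s)"
proof (cases "s = t")
  case True
  then show ?thesis using pos_diag[OF assms(1)] by (auto simp: complex_nonneg_Reals_iff complex_eq_iff)
next
  case False
  have q: "cnj x * A s s * x + cnj x * A s t * y + cnj y * A t s * x + cnj y * A t t * y \<in> \<real>\<^sub>\<ge>\<^sub>0" for x y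
    using pos[of "\<lambda>k. if k = s then x else if k = t then y else 0"]
    unfolding quad_two_points[OF fin assms False] .
  show ?thesis
    \<comment> \<open>Realness of the form at (1, 1) compares the imaginary parts of the two
      entries, realness at (1, i) their real parts.\<close>
    using q[of 1 1] q[of 1 \<i>] pos_diag[OF assms(1)] pos_diag[OF assms(2)]
    by (simp add: complex_nonneg_Reals_iff complex_eq_iff)
qed

text \<open>Without the term \<open>A s s\<close> the form is affine in the entry at
  \<open>s\<close>, hence unbounded below unless the coefficient \<open>A s t\<close>
  vanishes.\<close>

lemma pos_zero_row: assumes "s \<in> S" "t \<in> S" "A s s = 0" shows "A s t = 0"
proof (rule ccontr)
  assume nz: "A s t \<noteq> 0"
  then have ne: "s \<noteq> t" using assms by auto
  have q: "cnj x * A s t * y + cnj y * A t s * x + cnj y * A t t * y \<in> \<real>\<^sub>\<ge>\<^sub>0" for x y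
    using pos[of "\<lambda>k. if k = s then x else if k = t then y else 0"]
    unfolding quad_two_points[OF fin assms(1,2) ne] assms(3) by simp
  define n where "n = (norm (A s t))\<^sup>2"
  have n: "n > 0" using nz by (simp add: n_def)
  have st: "A t s = cnj (A s t)" by (rule pos_hermitian[OF assms(2,1)])
  have nn: "A s t * cnj (A s t) = of_real n" unfolding n_def by (rule complex_norm_square[symmetric])
  \<comment> \<open>Scaled so that each of the two cross terms is minus
    \<open>Re (A t t) + 1\<close>, which makes the real part of the form negative.\<close>
  define x where "x = - of_real ((Re (A t t) + 1) / n) * A s t"
  have "cnj x * A s t = - of_real (Re (A t t) + 1)"
    using n by (simp add: x_def nn mult.commute[of "cnj (A s t)"] mult.assoc)
  moreover have "A t s * x = - of_real (Re (A t t) + 1)"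
    using n by (simp add: x_def st nn mult.commute[of "cnj (A s t)"] mult.assoc mult.left_commute)
  ultimately have "0 \<le> - (2 * (Re (A t t) + 1)) + Re (A t t)"
    using q[of x 1] by (auto simp: complex_nonneg_Reals_iff)
  moreover have "Re (A t t) \<ge> 0" using pos_diag[OF assms(2)] by (auto simp: complex_nonneg_Reals_iff)
  ultimately show False by simp
qed

end

text \<open>Cholesky factorization, by iterated Schur complements.\<close>

lemma pos_decomposition:
  assumes "finite S" "\<And>v. quad S A v \<in> \<real>\<^sub>\<ge>\<^sub>0"
  shows "\<exists>zs. \<forall>i\<in>S. \<forall>j\<in>S. A i j = (\<Sum>z\<leftarrow>zs. z i * cnj (z j))"
  using assms
proof (induction S arbitrary: A rule: finite_induct)
  case empty
  show ?case by simp
next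
  case (insert s S)
  have fin: "finite (insert s S)" using insert by simp
  note dg = pos_diag[OF fin insert.prems]
    and herm = pos_hermitian[OF fin insert.prems] and zr = pos_zero_row[OF fin insert.prems]
  define a where "a = Re (A s s)"
  have Ass: "A s s = of_real a" and a: "a \<ge> 0"
    using dg[of s] by (auto simp: a_def complex_nonneg_Reals_iff complex_eq_iff)
  \<comment> \<open>The column to be split off. If the pivot is \<open>0\<close>, division by zero
    gives \<open>u = 0\<close>, which is right since \<open>pos_zero_row\<close> makes the column
    vanish.\<close>
  define u where "u = (\<lambda>i. A i s / of_real (sqrt a))"
  define B where "B = (\<lambda>i j. A i j - u i * cnj (u j))"
  have row: "B s j = 0" "B j s = 0" if "j \<in> insert s S" for j
  proof -
    have "B s j = 0 \<and> B j s = 0"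
    proof (cases "a = 0")
      case True
      then have "A s j = 0" using zr[of s j] that Ass by simp
      moreover have "A j s = 0" using herm[of j s] that calculation by simp
      ultimately show ?thesis by (simp add: B_def u_def True)
    next
      case False
      have "of_real (sqrt a) * of_real (sqrt a) = (of_real a :: complex)"
        using a by (simp flip: of_real_mult)
      then show ?thesis using False herm[of s j] that by (simp add: B_def u_def Ass)
    qed
    then show "B s j = 0" "B j s = 0" by auto
  qed
  have psdB: "quad S B v \<in> \<real>\<^sub>\<ge>\<^sub>0" for v
  proof -
    define c where "c = (\<Sum>j\<in>S. cnj (u j) * v j)"
    \<comment> \<open>The entry at \<open>s\<close> makes \<open>w\<close> orthogonal to
      \<open>u\<close>, so the form of \<open>A\<close> at \<open>w\<close> is that of
      \<open>B\<close> at \<open>v\<close>; for pivot \<open>0\<close> both \<open>u\<close> and the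
      quotient vanish.\<close>
    define w where "w = v(s := - c / of_real (sqrt a))"
    define r where "r = (\<Sum>j\<in>S. A s j * v j)"
    have wS: "w i = v i" if "i \<in> S" for i using that insert.hyps by (auto simp: w_def)
    have cc: "(\<Sum>i\<in>S. cnj (v i) * u i) = cnj c" by (simp add: c_def mult.commute)
    have qw: "quad (insert s S) A w = quad (insert s S) B w
        + (\<Sum>i\<in>insert s S. cnj (w i) * u i) * (\<Sum>j\<in>insert s S. cnj (u j) * w j)"
      by (simp only: quad_def B_def sum_product sum.distrib[symmetric]) (simp add: algebra_simps)
    have "quad (insert s S) B w = quad S B v"
      using insert.hyps row wS by (simp add: quad_insert) (simp add: quad_def wS cong: sum.cong)
    moreover have "(\<Sum>j\<in>insert s S. cnj (u j) * w j) = 0"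
    proof -
      have us: "cnj (u s) * w s = - c"
      proof (cases "a = 0")
        case True
        then have "u = (\<lambda>_. 0)" by (simp add: u_def)
        then show ?thesis by (simp add: c_def)
      next
        case False
        have "of_real (sqrt a) * of_real (sqrt a) = (of_real a :: complex)"
          using a by (simp flip: of_real_mult)
        then show ?thesis using False by (simp add: u_def w_def Ass)
      qed
      have "(\<Sum>j\<in>S. cnj (u j) * w j) = c" by (simp add: c_def wS cong: sum.cong)
      then show ?thesis using insert.hyps us by simp
    qed
    ultimately show ?thesis using insert.prems[of w] qw by simp
  qed
  obtain zs where zs: "\<forall>i\<in>S. \<forall>j\<in>S. B i j = (\<Sum>z\<leftarrow>zs. z i * cnj (z j))"
    using insert.IH[OF psdB] by blast
  \<comment> \<open>The induction hypothesis says nothing about the vectors at \<open>s\<close>;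
    they are set to \<open>0\<close> there, matching the zero row and column of
    \<open>B\<close>.\<close>
  have "A i j = (\<Sum>z\<leftarrow>u # map (\<lambda>z. z(s := 0)) zs. z i * cnj (z j))"
    if "i \<in> insert s S" "j \<in> insert s S" for i j
  proof -
    have "B i j = (\<Sum>z\<leftarrow>zs. (z(s := 0)) i * cnj ((z(s := 0)) j))"
      using that zs row by (cases "i = s"; cases "j = s") auto
    then show ?thesis by (simp add: B_def o_def algebra_simps)
  qed
  then show ?case by blast
qed

text \<open>Positivity on the index set with a record of the shape of the rank-one terms. With
  \<open>P\<close> always true it is just positivity; with \<open>P\<close> the predicate
  \<open>product_at d a l\<close> introduced below it is separability across the cut between
  \<open>l\<close> and the other labels.\<close>

definition gram :: "('l \<Rightarrow> nat) \<Rightarrow> 'l set \<Rightarrow> (('l midx \<Rightarrow> complex) \<Rightarrow> bool) \<Rightarrow> 'l opr \<Rightarrow> bool" where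
  "gram d a P R \<longleftrightarrow> (\<exists>zs. (\<forall>z\<in>set zs. P z) \<and>
     (\<forall>i\<in>idx d a. \<forall>j\<in>idx d a. R i j = (\<Sum>z\<leftarrow>zs. z i * cnj (z j))))"

lemma gramI:
  assumes "\<And>z. z \<in> set zs \<Longrightarrow> P z"
    "\<And>i j. i \<in> idx d a \<Longrightarrow> j \<in> idx d a \<Longrightarrow> R i j = (\<Sum>z\<leftarrow>zs. z i * cnj (z j))"
  shows "gram d a P R"
  using assms unfolding gram_def by blast

lemma psd_gram:
  assumes "finite a" "psd d a A"
  shows "gram d a (\<lambda>_. True) A"
  using pos_decomposition[of "idx d a" A] assms by (auto simp: psd_def quad_def gram_def)

lemma psd_rank_one:
  assumes "\<And>i j. A i j = (if i \<in> idx d a \<and> j \<in> idx d a then z i * cnj (z j) else 0)"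
  shows "psd d a A"
proof -
  have "(\<Sum>i\<in>idx d a. \<Sum>j\<in>idx d a. cnj (v i) * A i j * v j) \<in> \<real>\<^sub>\<ge>\<^sub>0" for v
  proof -
    define s where "s = (\<Sum>i\<in>idx d a. cnj (v i) * z i)"
    have "(\<Sum>i\<in>idx d a. \<Sum>j\<in>idx d a. cnj (v i) * A i j * v j) = s * cnj s"
      unfolding s_def cnj_sum sum_product
      by (intro sum.cong) (auto simp: assms)
    also have "\<dots> = of_real ((norm s)\<^sup>2)" by (rule complex_norm_square[symmetric])
    finally show ?thesis by (simp only: nonneg_Reals_of_real_iff) simp
  qed
  moreover have "A \<in> ops d a" by (auto simp: lin_def assms)
  ultimately show ?thesis by (simp add: psd_def)
qed

text \<open>The diagonal entry is the sum of the squared moduli of the entries \<open>z i\<close>,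
  so each of them must vanish.\<close>

lemma gram_zero_diag:
  assumes C: "gram d a P C" and i: "i \<in> idx d a" and "C i i = 0"
  shows "\<exists>zs. (\<forall>z\<in>set zs. P z \<and> z i = 0) \<and>
    (\<forall>i\<in>idx d a. \<forall>j\<in>idx d a. C i j = (\<Sum>z\<leftarrow>zs. z i * cnj (z j)))"
proof -
  obtain zs where zs: "\<forall>z\<in>set zs. P z"
    "\<forall>i\<in>idx d a. \<forall>j\<in>idx d a. C i j = (\<Sum>z\<leftarrow>zs. z i * cnj (z j))"
    using C by (auto simp: gram_def)
  have "(\<Sum>z\<leftarrow>zs. of_real ((norm (z i))\<^sup>2) :: complex) = 0"
    using zs(2) i assms(3) by (simp only: complex_norm_square)
  moreover have "(\<Sum>z\<leftarrow>zs. of_real ((norm (z i))\<^sup>2) :: complex) = of_real (\<Sum>z\<leftarrow>zs. (norm (z i))\<^sup>2)"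
    by (induction zs) auto
  ultimately have "(\<Sum>z\<leftarrow>zs. (norm (z i))\<^sup>2) = 0" by simp
  then have "\<forall>z\<in>set zs. (norm (z i))\<^sup>2 = 0"
    by (subst (asm) sum_list_nonneg_eq_0_iff) auto
  then show ?thesis using zs by auto
qed

text \<open>\<open>z\<close> is a product vector between the label \<open>l\<close> and the other labels; the exchange formulation
  avoids naming the two factors.\<close>

definition product_at :: "('l \<Rightarrow> nat) \<Rightarrow> 'l set \<Rightarrow> 'l \<Rightarrow> ('l midx \<Rightarrow> complex) \<Rightarrow> bool" where
  "product_at d a l z \<longleftrightarrow>
     (\<forall>i\<in>idx d a. \<forall>k\<in>idx d a. z i * z k = z (i(l := k l)) * z (k(l := i l)))"

text \<open>Every vector vanishes at the exchanged index, so the exchange identity makes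
  \<open>z i * z k\<close> vanish, and with it each term of \<open>C i k\<close>. This is the
  obstruction that excludes the entangled example from both classes.\<close>

lemma product_gram_zero:
  assumes C: "gram d a (product_at d a l) C"
    and i: "i \<in> idx d a" and k: "k \<in> idx d a" and l: "l \<in> a"
    and z: "C (i(l := k l)) (i(l := k l)) = 0"
  shows "C i k = 0"
proof -
  have u: "i(l := k l) \<in> idx d a" using i k l by (auto simp: idx_def PiE_def extensional_def)
  obtain zs where zs: "\<forall>z\<in>set zs. product_at d a l z \<and> z (i(l := k l)) = 0"
    "\<forall>i\<in>idx d a. \<forall>j\<in>idx d a. C i j = (\<Sum>z\<leftarrow>zs. z i * cnj (z j))"
    using gram_zero_diag[of d a "product_at d a l" C "i(l := k l)", OF C u z] by blast
  have "z i * z k = 0" if "z \<in> set zs" for z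
    using zs(1) that i k by (simp add: product_at_def)
  then have "\<forall>z\<in>set zs. z i * cnj (z k) = 0" by auto
  then have "(\<Sum>z\<leftarrow>zs. z i * cnj (z k)) = 0" by (induction zs) auto
  then show ?thesis using zs(2) i k by simp
qed

section \<open>Contractions of vectors and their product structure\<close>

lemma sum_sum_list: "(\<Sum>k\<in>K. \<Sum>x\<leftarrow>xs. f k x) = (\<Sum>x\<leftarrow>xs. \<Sum>k\<in>K. f k x :: complex)"
  by (induction xs) (auto simp: sum.distrib)

lemma sum_list_product:
  "(\<Sum>x\<leftarrow>xs. f x) * (\<Sum>y\<leftarrow>ys. g y) = (\<Sum>p\<leftarrow>List.product xs ys. f (fst p) * g (snd p) :: complex)"
proof (induction xs)
  case (Cons x xs)
  have "f x * (\<Sum>y\<leftarrow>ys. g y) = (\<Sum>p\<leftarrow>map (Pair x) ys. f (fst p) * g (snd p))"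
    by (simp add: o_def sum_list_const_mult)
  then show ?case using Cons by (simp add: distrib_right)
qed simp

text \<open>No conjugate appears: the transposition in the link product makes contraction bilinear
  in the vectors.\<close>

definition vlink :: "('l \<Rightarrow> nat) \<Rightarrow> 'l set \<Rightarrow> 'l set \<Rightarrow> ('l midx \<Rightarrow> complex) \<Rightarrow>
    ('l midx \<Rightarrow> complex) \<Rightarrow> 'l midx \<Rightarrow> complex" where
  "vlink d a b z w i =
     (\<Sum>k\<in>idx d (a \<inter> b). z (merge a (a \<inter> b) i k) * w (merge b (a \<inter> b) i k))"

text \<open>For |z><z| and |w><w| the sums over contracted row and column indices separate, so the
  link product is again rank one, with vector \<open>vlink d a b z w\<close>. Bilinearity extends
  this to sums.\<close>

lemma gram_link:
  assumes fin: "finite a" "finite b"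
    and A: "gram d a P A" and B: "gram d b Q B"
    and PQ: "\<And>z w. P z \<Longrightarrow> Q w \<Longrightarrow> T (vlink d a b z w)"
  shows "gram d (a \<union> b - a \<inter> b) T (snd (link d (a, A) (b, B)))"
proof -
  obtain zs where zs: "\<forall>z\<in>set zs. P z"
    "\<forall>i\<in>idx d a. \<forall>j\<in>idx d a. A i j = (\<Sum>z\<leftarrow>zs. z i * cnj (z j))"
    using A by (auto simp: gram_def)
  obtain ws where ws: "\<forall>z\<in>set ws. Q z"
    "\<forall>i\<in>idx d b. \<forall>j\<in>idx d b. B i j = (\<Sum>z\<leftarrow>ws. z i * cnj (z j))"
    using B by (auto simp: gram_def)
  let ?c = "a \<inter> b" and ?s = "a \<union> b - a \<inter> b"
  let ?vs = "map (\<lambda>p. vlink d a b (fst p) (snd p)) (List.product zs ws)"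
  show ?thesis
  proof (rule gramI[of ?vs])
    show "T v" if "v \<in> set ?vs" for v using that zs(1) ws(1) PQ by auto
  next
    fix i j assume i: "i \<in> idx d ?s" and j: "j \<in> idx d ?s"
    have m: "merge a ?c i k \<in> idx d a" "merge b ?c i k \<in> idx d b"
      "merge a ?c j k \<in> idx d a" "merge b ?c j k \<in> idx d b" if "k \<in> idx d ?c" for k
      by (rule merge_idx[OF i that] merge_idx[OF j that], blast)+
    have "snd (link d (a, A) (b, B)) i j = (\<Sum>k\<in>idx d ?c. \<Sum>l\<in>idx d ?c.
        A (merge a ?c i k) (merge a ?c j l) * B (merge b ?c i k) (merge b ?c j l))"
      using i j by (simp only: link_apply[OF fin] simp_thms if_True)
    also have "\<dots> = (\<Sum>k\<in>idx d ?c. \<Sum>l\<in>idx d ?c. \<Sum>p\<leftarrow>List.product zs ws.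
        (fst p (merge a ?c i k) * cnj (fst p (merge a ?c j l))) *
        (snd p (merge b ?c i k) * cnj (snd p (merge b ?c j l))))"
      using zs(2) ws(2) m by (intro sum.cong refl) (simp add: sum_list_product)
    also have "\<dots> = (\<Sum>p\<leftarrow>List.product zs ws.
        vlink d a b (fst p) (snd p) i * cnj (vlink d a b (fst p) (snd p) j))"
      unfolding sum_sum_list vlink_def sum_product cnj_sum
      by (intro arg_cong[of _ _ sum_list] map_cong refl sum.cong) simp
    finally show "snd (link d (a, A) (b, B)) i j = (\<Sum>v\<leftarrow>?vs. v i * cnj (v j))"
      by (simp add: o_def)
  qed
qed

text \<open>An uncontracted label \<open>l\<close> of \<open>w\<close> only passes through:
  exchanging it leaves the indices of \<open>z\<close> unchanged, so the exchange identity for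
  \<open>w\<close> applies to each pair of contracted indices.\<close>

lemma product_at_vlink:
  assumes l: "l \<in> b" "l \<notin> a" and w: "product_at d b l w"
  shows "product_at d (a \<union> b - a \<inter> b) l (vlink d a b z w)"
  unfolding product_at_def
proof (intro ballI)
  fix i k assume i: "i \<in> idx d (a \<union> b - a \<inter> b)" and k: "k \<in> idx d (a \<union> b - a \<inter> b)"
  let ?c = "a \<inter> b"
  have "w (merge b ?c i x) * w (merge b ?c k y) =
      w (merge b ?c (i(l := k l)) x) * w (merge b ?c (k(l := i l)) y)"
    if x: "x \<in> idx d ?c" and y: "y \<in> idx d ?c" for x y
  proof -
    have "merge b ?c i x \<in> idx d b" "merge b ?c k y \<in> idx d b"
      by (rule merge_idx[OF i x] merge_idx[OF k y], blast)+
    moreover have "(merge b ?c i x)(l := merge b ?c k y l) = merge b ?c (i(l := k l)) x"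
      "(merge b ?c k y)(l := merge b ?c i x l) = merge b ?c (k(l := i l)) y"
      using l by (auto simp: merge_def fun_eq_iff override_on_def)
    ultimately show ?thesis using w by (metis product_at_def)
  qed
  moreover have "merge a ?c (i(l := e)) x = merge a ?c i x" for i e x
    using l by (auto simp: merge_def fun_eq_iff override_on_def)
  ultimately show "vlink d a b z w i * vlink d a b z w k =
      vlink d a b z w (i(l := k l)) * vlink d a b z w (k(l := i l))"
    unfolding vlink_def sum_product
    by (intro sum.cong refl) (simp add: ac_simps)
qed

text \<open>If the contracted label \<open>m\<close> is a product factor of the left operand, the remaining part of the
  right operand splits off.\<close>

lemma product_at_vlink_contracted:
  assumes ab: "a \<inter> b = {m}" "b = {m, l}" and l: "l \<notin> a" and z: "product_at d a m z"
  shows "product_at d (a \<union> b - a \<inter> b) l (vlink d a b z w)"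
  unfolding product_at_def
proof (intro ballI)
  fix i k assume i: "i \<in> idx d (a \<union> b - a \<inter> b)" and k: "k \<in> idx d (a \<union> b - a \<inter> b)"
  have ma: "m \<in> a" "m \<noteq> l" using ab l by auto
  have za: "z (merge a {m} i x) * z (merge a {m} k y) = z (merge a {m} i y) * z (merge a {m} k x)"
    if x: "x \<in> idx d {m}" and y: "y \<in> idx d {m}" for x y
  proof -
    have "merge a {m} i x \<in> idx d a" "merge a {m} k y \<in> idx d a"
      using ab by (auto intro!: merge_idx[OF i x] merge_idx[OF k y])
    moreover have "(merge a {m} i x)(m := merge a {m} k y m) = merge a {m} i y"
      "(merge a {m} k y)(m := merge a {m} i x m) = merge a {m} k x"
      using ma by (auto simp: merge_def fun_eq_iff override_on_def)
    ultimately show ?thesis using z by (metis product_at_def)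
  qed
  have u: "merge a {m} (i(l := e)) x = merge a {m} i x" for i e x
    using l by (auto simp: merge_def fun_eq_iff override_on_def)
  have wb: "merge b {m} (i(l := k l)) x = merge b {m} k x" for i k x
    using ab(2) by (auto simp: merge_def fun_eq_iff override_on_def)
  let ?F = "\<lambda>x y. z (merge a {m} i x) * w (merge b {m} i x) * (z (merge a {m} k y) * w (merge b {m} k y))"
  let ?G = "\<lambda>x y. z (merge a {m} i x) * w (merge b {m} k x) * (z (merge a {m} k y) * w (merge b {m} i y))"
  \<comment> \<open>The exchange at \<open>m\<close> swaps the contracted indices \<open>x\<close>
    and \<open>y\<close> of the two copies of \<open>z\<close>. Renaming them moves the swap onto
    the two copies of \<open>w\<close>, where it is an exchange at \<open>l\<close> because
    \<open>b\<close> contains only \<open>m\<close> and \<open>l\<close>.\<close>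
  have "(\<Sum>x\<in>idx d {m}. \<Sum>y\<in>idx d {m}. ?F x y) = (\<Sum>x\<in>idx d {m}. \<Sum>y\<in>idx d {m}. ?G y x)"
  proof (intro sum.cong refl)
    fix x y assume "x \<in> idx d {m}" "y \<in> idx d {m}"
    from za[OF this] show "?F x y = ?G y x" by algebra
  qed
  also have "\<dots> = (\<Sum>x\<in>idx d {m}. \<Sum>y\<in>idx d {m}. ?G x y)" by (rule sum.swap)
  finally show "vlink d a b z w i * vlink d a b z w k =
      vlink d a b z w (i(l := k l)) * vlink d a b z w (k(l := i l))"
    unfolding vlink_def sum_product ab(1) u wb .
qed

section \<open>Processes with classical memory and separable processes\<close>

text \<open>Time labels are compared syntactically, so \<open>1\<close> must not be rewritten to \<open>Suc 0\<close>.\<close>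

declare One_nat_def [simp del]

lemma gram_sum:
  fixes n :: nat
  assumes "\<And>x. x < n \<Longrightarrow> gram d a P (A x)"
  shows "gram d a P (\<lambda>i j. \<Sum>x<n. A x i j)"
  using assms
proof (induction n)
  case 0
  show ?case by (rule gramI[of "[]"]) auto
next
  case (Suc n)
  then have "gram d a P (\<lambda>i j. \<Sum>x<n. A x i j)" "gram d a P (A n)" by auto
  then obtain zs ws where
    "\<forall>z\<in>set zs. P z" "\<forall>i\<in>idx d a. \<forall>j\<in>idx d a. (\<Sum>x<n. A x i j) = (\<Sum>z\<leftarrow>zs. z i * cnj (z j))"
    "\<forall>z\<in>set ws. P z" "\<forall>i\<in>idx d a. \<forall>j\<in>idx d a. A n i j = (\<Sum>z\<leftarrow>ws. z i * cnj (z j))"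
    by (auto simp: gram_def)
  then show ?case by (intro gramI[of "zs @ ws"]) auto
qed

lemma gram_product_at_scale:
  assumes A: "gram d a (product_at d a l) A" and c: "0 \<le> c"
  shows "gram d a (product_at d a l) (\<lambda>i j. of_real c * A i j)"
proof -
  obtain zs where zs: "\<forall>z\<in>set zs. product_at d a l z"
    "\<forall>i\<in>idx d a. \<forall>j\<in>idx d a. A i j = (\<Sum>z\<leftarrow>zs. z i * cnj (z j))"
    using A by (auto simp: gram_def)
  define g where "g = (\<lambda>z :: 'a midx \<Rightarrow> complex. \<lambda>i. of_real (sqrt c) * z i)"
  have cc: "of_real (sqrt c) * of_real (sqrt c) = (of_real c :: complex)"
    using c by (simp flip: of_real_mult)
  show ?thesis
  proof (rule gramI[of "map g zs"])
    fix w assume "w \<in> set (map g zs)"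
    then show "product_at d a l w" using zs(1) by (auto simp: product_at_def g_def mult.assoc mult.left_commute)
  next
    fix i j assume "i \<in> idx d a" "j \<in> idx d a"
    then have "of_real c * A i j = (\<Sum>z\<leftarrow>zs. of_real c * (z i * cnj (z j)))"
      using zs(2) by (simp add: sum_list_const_mult)
    also have "\<dots> = (\<Sum>z\<leftarrow>map g zs. z i * cnj (z j))"
      by (simp add: g_def o_def cc[symmetric] ac_simps)
    finally show "of_real c * A i j = (\<Sum>z\<leftarrow>map g zs. z i * cnj (z j))" .
  qed
qed

text \<open>With one label the exchange merely swaps \<open>i\<close> and \<open>k\<close>.\<close>

lemma product_at_singleton: "product_at d {l} l z"
proof -
  have "i(l := k l) = k" if "i \<in> idx d {l}" "k \<in> idx d {l}" for i k
    using that by (intro ext) (auto simp: idx_undefined)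
  then show ?thesis by (simp add: product_at_def)
qed

text \<open>With nothing to contract, tensor products inherit their product structure from the
  results on link products.\<close>

lemma tensor_link:
  assumes "finite a" "finite b" "a \<inter> b = {}"
  shows "tensor d a b A B = snd (link d (a, A) (b, B))"
proof (intro ext)
  fix i j
  have "merge a {} i k = restrict i a" "merge b {} i k = restrict i b" for i k :: "'a midx"
    by (auto simp: merge_def override_on_def)
  then show "tensor d a b A B i j = snd (link d (a, A) (b, B)) i j"
    unfolding link_apply[OF assms(1,2)] using assms(3) by (simp add: tensor_def)
qed

lemma gram_tensor:
  assumes "finite a" "finite b" "a \<inter> b = {}" "l \<in> b"
    and "gram d a (\<lambda>_. True) A" "gram d b (product_at d b l) B"
  shows "gram d (a \<union> b) (product_at d (a \<union> b) l) (tensor d a b A B)"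
proof -
  have "gram d (a \<union> b - a \<inter> b) (product_at d (a \<union> b - a \<inter> b) l) (snd (link d (a, A) (b, B)))"
    using assms by (intro gram_link[where P="\<lambda>_. True" and Q="product_at d b l"] product_at_vlink) auto
  then show ?thesis unfolding tensor_link[OF assms(1-3)] assms(3) Diff_empty .
qed

text \<open>Measure-and-prepare terms are tensor products of positive operators on one label each,
  and every vector on one label is trivially a product vector.\<close>

lemma entanglement_breaking_gram:
  assumes "entanglement_breaking_choi d l l' X" "l \<noteq> l'"
  shows "gram d {l', l} (product_at d {l', l} l) X"
proof -
  obtain n \<sigma> M where s: "\<forall>x<n. density d {l'} (\<sigma> x)" and M: "povm d {l} n M"
    and X: "X = (\<lambda>i j. \<Sum>x<n. tensor d {l'} {l} (\<sigma> x) (M x) i j)"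
    using assms(1) unfolding entanglement_breaking_choi_def by blast
  have "gram d ({l'} \<union> {l}) (product_at d ({l'} \<union> {l}) l) (tensor d {l'} {l} (\<sigma> x) (M x))" if "x < n" for x
  proof (rule gram_tensor)
    show "gram d {l'} (\<lambda>_. True) (\<sigma> x)" using s that by (auto intro: psd_gram simp: density_def)
    have "gram d {l} (\<lambda>_. True) (M x)" using M that by (auto intro: psd_gram simp: povm_def)
    then show "gram d {l} (product_at d {l} l) (M x)" by (simp add: gram_def product_at_singleton)
  qed (use assms in auto)
  then show ?thesis unfolding X by (intro gram_sum) (simp add: insert_commute)
qed

section \<open>Choi operators of unitary conjugations\<close>

lemma choi_apply:
  assumes "finite a"
  shows "choi d a b K i j = (if i \<in> idx d (a \<union> b) \<and> j \<in> idx d (a \<union> b)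
    then K (mat_unit (restrict i a) (restrict j a)) (restrict i b) (restrict j b) else 0)"
proof (cases "i \<in> idx d (a \<union> b) \<and> j \<in> idx d (a \<union> b)")
  case True
  then have ij: "restrict i a \<in> idx d a" "restrict j a \<in> idx d a" by (auto dest: idx_less)
  have "choi d a b K i j = (\<Sum>m\<in>idx d a. if restrict i a = m then \<Sum>n\<in>idx d a. if restrict j a = n then
      K (mat_unit m n) (restrict i b) (restrict j b) else 0 else 0)"
    unfolding choi_def using True by (intro sum.cong refl) (auto simp: tensor_def mat_unit_def intro!: sum.cong)
  also have "\<dots> = K (mat_unit (restrict i a) (restrict j a)) (restrict i b) (restrict j b)"
    using assms ij by (simp add: sum.delta')
  finally show ?thesis using True by simp
next
  case False
  then show ?thesis by (auto simp: choi_def tensor_def)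
qed

text \<open>The Choi operator is rank one; its vector is \<open>V\<close> with row and column read
  as one multi-index.\<close>

lemma unitary_conj_choi_apply:
  assumes "finite a"
  shows "choi d a b (\<lambda>A. mult d a (mult d a V A) (adj V)) i j =
    (if i \<in> idx d (a \<union> b) \<and> j \<in> idx d (a \<union> b)
     then V (restrict i b) (restrict i a) * cnj (V (restrict j b) (restrict j a)) else 0)"
proof -
  have "mult d a (mult d a V (mat_unit m n)) (adj V) p q = V p m * cnj (V q n)"
    if mn: "m \<in> idx d a" "n \<in> idx d a" for m n p q
  proof -
    have "mult d a V (mat_unit m n) p k = (\<Sum>x\<in>idx d a. if x = m then if k = n then V p m else 0 else 0)" for k
      unfolding mult_def mat_unit_def by (intro sum.cong) auto
    then have *: "mult d a V (mat_unit m n) p = (\<lambda>k. if k = n then V p m else 0)"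
      by (intro ext) (use mn assms in simp)
    have "mult d a (mult d a V (mat_unit m n)) (adj V) p q =
        (\<Sum>k\<in>idx d a. if k = n then V p m * cnj (V q n) else 0)"
      unfolding mult_def[of _ _ _ "adj V"] * by (auto simp: adj_def intro!: sum.cong)
    then show ?thesis using mn assms by simp
  qed
  moreover have "restrict i a \<in> idx d a" if "i \<in> idx d (a \<union> b)" for i
    using that by (auto dest: idx_less)
  ultimately show ?thesis using assms by (simp add: choi_apply)
qed

lemma unitary_choi_gram:
  assumes "unitary_choi d a b U" "finite a"
  shows "gram d (a \<union> b) (\<lambda>_. True) U"
proof -
  obtain V where "U = choi d a b (\<lambda>A. mult d a (mult d a V A) (adj V))"
    using assms(1) by (auto simp: unitary_choi_def)
  then show ?thesis using assms(2)
    by (intro gramI[of "[\<lambda>i. V (restrict i b) (restrict i a)]"]) (auto simp: unitary_conj_choi_apply)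
qed

section \<open>Stages of the iterated link product\<close>

definition stage :: "nat \<Rightarrow> label set" where
  "stage n = sys n \<union> {EI n}"

lemma finite_sys [simp]: "finite (sys n)" by (simp add: sys_def)
lemma finite_stage [simp]: "finite (stage n)" by (simp add: stage_def)

lemma sys_Suc: "1 \<le> n \<Longrightarrow> sys (Suc n) = {SI (Suc n), SO n} \<union> sys n"
  by (auto simp: sys_def le_Suc_eq less_Suc_eq)

lemma mem_sys [simp]:
  "SI j \<in> sys n \<longleftrightarrow> 1 \<le> j \<and> j \<le> n" "SO j \<in> sys n \<longleftrightarrow> 1 \<le> j \<and> j < n"
  "EI j \<notin> sys n" "EO j \<notin> sys n"
  by (auto simp: sys_def)

lemma mem_stage [simp]:
  "SI j \<in> stage n \<longleftrightarrow> 1 \<le> j \<and> j \<le> n" "SO j \<in> stage n \<longleftrightarrow> 1 \<le> j \<and> j < n"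
  "EI j \<in> stage n \<longleftrightarrow> j = n" "EO j \<notin> stage n"
  by (auto simp: stage_def)

abbreviation u_labels :: "nat \<Rightarrow> label set" where
  "u_labels j \<equiv> {EI (j + 1), SI (j + 1), EO j, SO j}"
abbreviation t_labels :: "nat \<Rightarrow> label set" where
  "t_labels j \<equiv> {EI (j + 1), SI (j + 1), SO j, EI j}"

lemma u_labels_Int: "u_labels j \<inter> {EO j, EI j} = {EO j}" by auto
lemma u_labels_diff: "u_labels j \<union> {EO j, EI j} - u_labels j \<inter> {EO j, EI j} = t_labels j" by auto
lemma t_labels_Int: "t_labels j \<inter> stage j = {EI j}" by (auto simp: stage_def sys_def)
lemma t_labels_diff: "1 \<le> j \<Longrightarrow> t_labels j \<union> stage j - t_labels j \<inter> stage j = stage (Suc j)"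
  unfolding t_labels_Int by (auto simp: stage_def sys_Suc)
lemma stage_1: "stage 1 = {EI 1, SI 1}" by (auto simp: stage_def sys_def)
lemma stage_final: "{EI n} \<union> stage n - {EI n} \<inter> stage n = sys n" by (auto simp: stage_def)

definition step_op :: "(label \<Rightarrow> nat) \<Rightarrow> (nat \<Rightarrow> label opr) \<Rightarrow> (nat \<Rightarrow> label opr) \<Rightarrow> nat \<Rightarrow> label opr" where
  "step_op d U X j = snd (link d (u_labels j, U j) ({EO j, EI j}, X j))"

text \<open>The operators of the fold without their label sets: at \<open>n\<close> the open labels
  are those of the system up to time \<open>n\<close> and the environment input \<open>EI n\<close>.
  Times start at \<open>1\<close>; the value at \<open>0\<close> is a dummy.\<close>

fun stage_op :: "(label \<Rightarrow> nat) \<Rightarrow> (nat \<Rightarrow> label opr) \<Rightarrow> (nat \<Rightarrow> label opr) \<Rightarrow> label opr \<Rightarrow> nat \<Rightarrow> label opr" where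
  "stage_op d U X \<rho> 0 = \<rho>"
| "stage_op d U X \<rho> (Suc n) = (if n = 0 then \<rho> else
     snd (link d (t_labels n, step_op d U X n) (stage n, stage_op d U X \<rho> n)))"

lemma stage_op_1 [simp]: "stage_op d U X \<rho> 1 = \<rho>"
  by (simp add: One_nat_def)

lemma fst_link: "fst (link d (a, A) (b, B)) = a \<union> b - a \<inter> b" by simp

lemma fold_stage_op:
  assumes "1 \<le> n"
  shows "fold (\<lambda>j R. link d (link d (u_labels j, U j) ({EO j, EI j}, X j)) R) [1..<n] ({EI 1, SI 1}, \<rho>)
    = (stage n, stage_op d U X \<rho> n)"
  using assms
proof (induction n rule: dec_induct)
  case base
  show ?case by (simp add: stage_1[simplified])
next
  case (step n)
  have "link d (u_labels n, U n) ({EO n, EI n}, X n) = (t_labels n, step_op d U X n)"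
    unfolding step_op_def by (rule prod_eqI) (simp_all only: fst_link u_labels_diff fst_conv snd_conv)
  moreover have "link d (t_labels n, step_op d U X n) (stage n, stage_op d U X \<rho> n)
      = (stage (Suc n), stage_op d U X \<rho> (Suc n))"
    using step by (intro prod_eqI) (simp_all only: fst_link t_labels_diff fst_conv snd_conv stage_op.simps, simp)
  moreover have "[1..<Suc n] = [1..<n] @ [n]" using step by simp
  ultimately show ?case using step by (simp del: link.simps)
qed

text \<open>Label bookkeeping is settled here once, so that the later arguments concern operators
  only.\<close>

lemma process_form_iff:
  assumes "1 \<le> N"
  shows "process_form N d X C \<longleftrightarrow> (\<exists>\<rho> U.
     density d {EI 1, SI 1} \<rho> \<and>
     (\<forall>j\<in>{1..<N}. unitary_choi d {EO j, SO j} {EI (j + 1), SI (j + 1)} (U j)) \<and>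
     (\<forall>j\<in>{1..<N}. channel_choi d {EI j} {EO j} (X j)) \<and>
     C = snd (link d ({EI N}, ident d {EI N}) (stage N, stage_op d U X \<rho> N)))"
proof -
  have "(sys N, C) = link d ({EI N}, ident d {EI N}) (stage N, stage_op d U X \<rho> N) \<longleftrightarrow>
    C = snd (link d ({EI N}, ident d {EI N}) (stage N, stage_op d U X \<rho> N))" for \<rho> U
    by (simp only: prod_eq_iff fst_link stage_final fst_conv snd_conv simp_thms)
  then show ?thesis unfolding process_form_def fold_stage_op[OF assms] by simp
qed

lemma ident_gram:
  assumes "finite a"
  shows "gram d a (\<lambda>_. True) (ident d a)"
proof -
  obtain ks where ks: "set ks = idx d a" "distinct ks"
    using finite_distinct_list[OF finite_idx[OF assms]] by blast
  show ?thesis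
  proof (rule gramI[of "map (\<lambda>k i. if i = k then 1 else 0) ks"])
    fix i j assume i: "i \<in> idx d a" and j: "j \<in> idx d a"
    have "(\<Sum>z\<leftarrow>map (\<lambda>k i. if i = k then 1 else 0) ks. z i * cnj (z j)) =
        (\<Sum>k\<in>idx d a. if i = k then if j = k then 1 else 0 else 0 :: complex)"
      using ks by (auto simp: o_def sum_list_distinct_conv_sum_set intro!: sum.cong)
    also have "\<dots> = ident d a i j" using i assms by (simp add: ident_def)
    finally show "ident d a i j = (\<Sum>z\<leftarrow>map (\<lambda>k i. if i = k then 1 else 0) ks. z i * cnj (z j))" by simp
  qed simp
qed

text \<open>The initial state may be entangled between \<open>EI 1\<close> and \<open>SI 1\<close>,
  so the invariant starts at \<open>n = 2\<close>: contracting \<open>EI 1\<close> with an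
  entanglement-breaking memory disentangles \<open>SI 1\<close>, which is never contracted.\<close>

lemma classical_memory_gram:
  assumes N: "2 \<le> N" and C: "process_form N d X C"
    and eb: "\<And>j. j \<in> {1..<N} \<Longrightarrow> entanglement_breaking_choi d (EI j) (EO j) (X j)"
  shows "gram d (sys N) (product_at d (sys N) (SI 1)) C"
proof -
  have "1 \<le> N" using N by simp
  from C[unfolded process_form_iff[OF this]]
  obtain \<rho> U where \<rho>: "density d {EI 1, SI 1} \<rho>"
    and U: "\<And>j. j \<in> {1..<N} \<Longrightarrow> unitary_choi d {EO j, SO j} {EI (j + 1), SI (j + 1)} (U j)"
    and C: "C = snd (link d ({EI N}, ident d {EI N}) (stage N, stage_op d U X \<rho> N))"
    by blast
  have gT: "gram d (t_labels j) (product_at d (t_labels j) (EI j)) (step_op d U X j)"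
    if j: "j \<in> {1..<N}" for j
  proof -
    have "u_labels j = {EO j, SO j} \<union> {EI (j + 1), SI (j + 1)}" by auto
    then have gU: "gram d (u_labels j) (\<lambda>_. True) (U j)"
      using unitary_choi_gram[OF U[OF j]] by simp
    have gX: "gram d {EO j, EI j} (product_at d {EO j, EI j} (EI j)) (X j)"
      using entanglement_breaking_gram[OF eb[OF j]] by simp
    \<comment> \<open>Linking the unitary contracts only \<open>EO j\<close>, so \<open>EI j\<close>
      stays a product factor.\<close>
    show ?thesis unfolding step_op_def u_labels_diff[symmetric]
      by (rule gram_link[OF _ _ gU gX], simp, simp, rule product_at_vlink) auto
  qed
  have "gram d (stage n) (product_at d (stage n) (SI 1)) (stage_op d U X \<rho> n)" if n: "2 \<le> n" "n \<le> N" for n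
    using n
  proof (induction n rule: dec_induct)
    case base
    have g\<rho>: "gram d (stage 1) (\<lambda>_. True) \<rho>"
      using \<rho> unfolding stage_1 by (auto intro!: psd_gram simp: density_def)
    have "gram d (stage (Suc 1)) (product_at d (stage (Suc 1)) (SI 1))
        (snd (link d (t_labels 1, step_op d U X 1) (stage 1, \<rho>)))"
      unfolding t_labels_diff[OF order.refl, symmetric]
    proof (rule gram_link[OF _ _ gT g\<rho>])
      fix z w assume "product_at d (t_labels 1) (EI 1) z"
      then show "product_at d (t_labels 1 \<union> stage 1 - t_labels 1 \<inter> stage 1) (SI 1)
          (vlink d (t_labels 1) (stage 1) z w)"
        using stage_1 by (intro product_at_vlink_contracted[OF t_labels_Int]) auto
    qed (use N in auto)
    moreover have "stage_op d U X \<rho> 1 = \<rho>" by simp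
    ultimately show ?case by (simp add: numeral_2_eq_2 One_nat_def del: link.simps)
  next
    case (step n)
    then have n: "1 \<le> n" "n \<noteq> 0" and nN: "n \<in> {1..<N}" by auto
    have IH: "gram d (stage n) (product_at d (stage n) (SI 1)) (stage_op d U X \<rho> n)"
      using step by simp
    have "gram d (stage (Suc n)) (product_at d (stage (Suc n)) (SI 1))
        (snd (link d (t_labels n, step_op d U X n) (stage n, stage_op d U X \<rho> n)))"
      unfolding t_labels_diff[OF n(1), symmetric]
      by (rule gram_link[OF _ _ gT[OF nN] IH], simp, simp, rule product_at_vlink) (use n step in auto)
    then show ?case using n by simp
  qed
  then have R: "gram d (stage N) (product_at d (stage N) (SI 1)) (stage_op d U X \<rho> N)" using N by simp
  show ?thesis unfolding C stage_final[symmetric]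
    by (rule gram_link[OF _ _ ident_gram R], simp, simp, simp, rule product_at_vlink) (use N in auto)
qed

text \<open>\<open>SI 1\<close> starts as the only label and stays in the right operand of every
  further tensor product, so it remains a product factor.\<close>

lemma separable_fold_gram:
  assumes "1 \<le> n" and \<rho>: "psd d {SI 1} \<rho>" and L: "\<forall>j\<in>{1..<n}. psd d {SI (j + 1), SO j} (L j)"
  shows "fst (fold (\<lambda>j. ltensor d ({SI (j + 1), SO j}, L j)) [1..<n] ({SI 1}, \<rho>)) = sys n \<and>
    gram d (sys n) (product_at d (sys n) (SI 1))
      (snd (fold (\<lambda>j. ltensor d ({SI (j + 1), SO j}, L j)) [1..<n] ({SI 1}, \<rho>)))"
  using assms(1) L
proof (induction n rule: dec_induct)
  case base
  have "gram d {SI 1} (\<lambda>_. True) \<rho>" using \<rho> by (auto intro: psd_gram)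
  then have "gram d {SI 1} (product_at d {SI 1} (SI 1)) \<rho>" by (simp add: gram_def product_at_singleton)
  moreover have "sys 1 = {SI 1}" by (auto simp: sys_def)
  ultimately show ?case by simp
next
  case (step n)
  let ?R = "fold (\<lambda>j. ltensor d ({SI (j + 1), SO j}, L j)) [1..<n] ({SI 1}, \<rho>)"
  obtain R where R: "?R = (sys n, R)" "gram d (sys n) (product_at d (sys n) (SI 1)) R"
  proof -
    have "\<forall>j\<in>{1..<n}. psd d {SI (j + 1), SO j} (L j)" using step.prems by auto
    from step.IH[OF this] show thesis by (intro that[of "snd ?R"]) (auto simp: prod_eq_iff)
  qed
  have "gram d {SI (n + 1), SO n} (\<lambda>_. True) (L n)" using step by (intro psd_gram) auto
  moreover have eq: "sys (Suc n) = {SI (n + 1), SO n} \<union> sys n" using sys_Suc[OF step(1)] by (simp flip: Suc_eq_plus1)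
  ultimately have "gram d (sys (Suc n)) (product_at d (sys (Suc n)) (SI 1))
      (tensor d {SI (n + 1), SO n} (sys n) (L n) R)"
    unfolding eq using R(2) step(1) by (intro gram_tensor) auto
  moreover have "[1..<Suc n] = [1..<n] @ [n]" using step by simp
  ultimately show ?case using R(1) by (simp add: eq)
qed

lemma separable_gram:
  assumes "(d, C) \<in> SEP N" "1 \<le> N"
  shows "gram d (sys N) (product_at d (sys N) (SI 1)) C"
proof -
  obtain n :: nat and p L \<rho> where p: "\<forall>x<n. 0 \<le> (p x :: real)"
    and \<rho>: "\<forall>x<n. psd d {SI 1} (\<rho> x)"
    and L: "\<forall>x<n. \<forall>j\<in>{1..<N}. psd d {SI (j + 1), SO j} (L x j)"
    and C: "C = (\<lambda>i k. \<Sum>x<n. of_real (p x) *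
       snd (fold (\<lambda>j. ltensor d ({SI (j + 1), SO j}, L x j)) [1..<N] ({SI 1}, \<rho> x)) i k)"
    using assms(1) unfolding SEP_def by blast
  show ?thesis unfolding C
    using p \<rho> L separable_fold_gram[OF assms(2)] by (intro gram_sum gram_product_at_scale) auto
qed

section \<open>Permutation unitaries and memory channels\<close>

lemma sum_nonneg_Reals:
  fixes n :: nat
  assumes "\<And>x. f x \<in> \<real>\<^sub>\<ge>\<^sub>0"
  shows "(\<Sum>x<n. f x) \<in> \<real>\<^sub>\<ge>\<^sub>0"
  by (induction n) (auto simp: assms intro: nonneg_Reals_add_I)

lemma sum_idx_pair:
  assumes "l \<noteq> m"
  shows "(\<Sum>k\<in>idx d {l, m}. F (k l, k m)) = (\<Sum>p\<in>{..<d l} \<times> {..<d m}. F p)"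
  using assms by (simp add: sum_idx_insert sum_idx_singleton sum.cartesian_product)

lemma idx_pair_eq:
  assumes "i \<in> idx d {l, m}" "j \<in> idx d {l, m}"
  shows "(i l, i m) = (j l, j m) \<longleftrightarrow> i = j"
  using assms by (auto intro: idx_ext)

definition pair_perm :: "('l \<Rightarrow> nat) \<Rightarrow> 'l \<Rightarrow> 'l \<Rightarrow> 'l \<Rightarrow> 'l \<Rightarrow> (nat \<times> nat \<Rightarrow> nat \<times> nat) \<Rightarrow> 'l opr" where
  "pair_perm d l m l' m' f = (\<lambda>i j. if i \<in> idx d {l', m'} \<and> j \<in> idx d {l, m} \<and>
     (i l', i m') = f (j l, j m) then 1 else 0)"

lemma unitary_pair_perm:
  assumes lm: "l \<noteq> m" "l' \<noteq> m'"
    and f: "bij_betw f ({..<d l} \<times> {..<d m}) ({..<d l'} \<times> {..<d m'})"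
  shows "unitary d {l, m} {l', m'} (pair_perm d l m l' m' f)"
proof -
  let ?V = "pair_perm d l m l' m' f" and ?A = "{..<d l} \<times> {..<d m}" and ?B = "{..<d l'} \<times> {..<d m'}"
  have fin: "finite ?A" "finite ?B" by auto
  have mem: "(i l, i m) \<in> ?A" if "i \<in> idx d {l, m}" for i using that by (auto dest: idx_less)
  have mem': "(i l', i m') \<in> ?B" if "i \<in> idx d {l', m'}" for i using that by (auto dest: idx_less)
  have "mult d {l', m'} (adj ?V) ?V i j = ident d {l, m} i j" for i j
  proof (cases "i \<in> idx d {l, m} \<and> j \<in> idx d {l, m}")
    case True
    have "mult d {l', m'} (adj ?V) ?V i j =
        (\<Sum>k\<in>idx d {l', m'}. (\<lambda>p. if p = f (i l, i m) then if p = f (j l, j m) then 1 else 0 else 0) (k l', k m'))"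
      unfolding mult_def adj_def pair_perm_def using True by (intro sum.cong) auto
    also have "\<dots> = (if f (i l, i m) = f (j l, j m) then 1 else 0)"
      using bij_betwE[OF f] mem True fin by (subst sum_idx_pair[OF lm(2)]) simp
    also have "\<dots> = ident d {l, m} i j"
      using bij_betw_imp_inj_on[OF f] mem True idx_pair_eq[of i d l m j]
      by (auto simp: ident_def inj_on_eq_iff)
    finally show ?thesis .
  next
    case False
    then show ?thesis by (auto simp: mult_def adj_def pair_perm_def ident_def)
  qed
  moreover have "mult d {l, m} ?V (adj ?V) i j = ident d {l', m'} i j" for i j
  proof (cases "i \<in> idx d {l', m'} \<and> j \<in> idx d {l', m'}")
    case True
    have "mult d {l, m} ?V (adj ?V) i j =
        (\<Sum>k\<in>idx d {l, m}. (\<lambda>p. (\<lambda>q. if q = (i l', i m') then if q = (j l', j m') then 1 else 0 else 0) (f p)) (k l, k m))"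
      unfolding mult_def adj_def pair_perm_def using True by (intro sum.cong) auto
    also have "\<dots> = (\<Sum>q\<in>?B. if q = (i l', i m') then if q = (j l', j m') then 1 else 0 else 0)"
      by (subst sum_idx_pair[OF lm(1)]) (rule sum.reindex_bij_betw[OF f])
    also have "\<dots> = (if (i l', i m') = (j l', j m') then 1 else 0)"
      using mem' True fin by simp
    also have "\<dots> = ident d {l', m'} i j"
      unfolding idx_pair_eq[OF conjunct1[OF True] conjunct2[OF True]] using True by (simp add: ident_def)
    finally show ?thesis .
  next
    case False
    then show ?thesis by (auto simp: mult_def adj_def pair_perm_def ident_def)
  qed
  moreover have "?V \<in> lin d {l, m} {l', m'}" by (auto simp: lin_def pair_perm_def)
  ultimately show ?thesis by (simp add: unitary_def fun_eq_iff)
qed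

text \<open>Entrywise multiplication by the Gram matrix of the weights, followed by relabelling: the
  map with diagonal Kraus operators \<open>w x\<close>. One constant weight \<open>1\<close> gives
  the identity map, indicator weights give complete dephasing.\<close>

definition pinch :: "('l \<Rightarrow> nat) \<Rightarrow> nat \<Rightarrow> (nat \<Rightarrow> nat \<Rightarrow> real) \<Rightarrow> 'l \<Rightarrow> 'l \<Rightarrow> 'l opr \<Rightarrow> 'l opr" where
  "pinch d n w l l' A = (\<lambda>i j. (\<Sum>x<n. of_real (w x (i l') * w x (j l'))) * relabel d l l' A i j)"

lemma ampliation_apply:
  assumes "r \<notin> b"
  shows "ampliation d a b r K P i j = (if i \<in> idx d (insert r b) \<and> j \<in> idx d (insert r b)
    then K (block d a r P (restrict i {r}) (restrict j {r})) (restrict i b) (restrict j b) else 0)"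
proof (cases "i \<in> idx d (insert r b) \<and> j \<in> idx d (insert r b)")
  case True
  then have ij: "restrict i {r} \<in> idx d {r}" "restrict j {r} \<in> idx d {r}" by (auto dest: idx_less)
  let ?k = "K (block d a r P (restrict i {r}) (restrict j {r})) (restrict i b) (restrict j b)"
  have *: "tensor d b {r} (K (block d a r P s t)) (mat_unit s t) i j =
      (if restrict i {r} = s then if restrict j {r} = t then ?k else 0 else 0)" for s t
    using True by (auto simp: tensor_def mat_unit_def)
  have "ampliation d a b r K P i j = (\<Sum>s\<in>idx d {r}. if restrict i {r} = s then \<Sum>t\<in>idx d {r}.
      if restrict j {r} = t then ?k else 0 else 0)"
    unfolding ampliation_def * by (intro sum.cong refl) simp
  also have "\<dots> = ?k"
    using ij by (simp add: sum.delta')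
  finally show ?thesis using True by simp
next
  case False
  then show ?thesis by (auto simp: ampliation_def tensor_def)
qed

text \<open>Diagonal Kraus operators turn the form of the output into a sum of forms of
  \<open>P\<close> at reweighted vectors, which gives complete positivity; the normalization of the
  weights preserves the diagonal and hence the trace.\<close>

lemma channel_pinch:
  assumes ll: "l \<noteq> l'" and dim: "d l = d l'" and w: "\<And>e. e < d l \<Longrightarrow> (\<Sum>x<n. w x e * w x e) = 1"
  shows "channel d {l} {l'} (pinch d n w l l')"
proof -
  let ?K = "pinch d n w l l'"
  have "linear_map d {l} {l'} ?K"
    by (auto simp: linear_map_def pinch_def relabel_def lin_def fun_eq_iff algebra_simps)
  moreover have "trace d {l'} (?K A) = trace d {l} A" for A
  proof -
    have "trace d {l'} (?K A) = (\<Sum>e<d l'. A (\<lambda>_\<in>{l}. e) (\<lambda>_\<in>{l}. e))"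
      unfolding trace_def sum_idx_singleton pinch_def relabel_def
      by (intro sum.cong refl) (use dim w in \<open>simp flip: of_real_sum of_real_mult\<close>)
    then show ?thesis by (simp add: trace_def sum_idx_singleton dim)
  qed
  moreover have "completely_positive d {l} {l'} ?K"
    unfolding completely_positive_def
  proof (intro allI impI, elim conjE)
    fix r k P assume r: "r \<notin> {l} \<union> {l'}" and P: "psd (d(r := k)) (insert r {l}) P"
    let ?d = "d(r := k)"
    have rl: "r \<noteq> l" "r \<noteq> l'" using r by auto
    define h where "h = (\<lambda>i. \<lambda>x\<in>{r, l}. if x = l then i l' else i r :: nat)"
    define g where "g = (\<lambda>i. \<lambda>x\<in>{r, l'}. if x = l' then i l else i r :: nat)"
    have h_idx: "h i \<in> idx ?d {r, l}" if "i \<in> idx ?d {r, l'}" for i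
      using that dim rl by (auto simp: h_def dest: idx_less split: if_splits)
    have g_idx: "g i \<in> idx ?d {r, l'}" if "i \<in> idx ?d {r, l}" for i
      using that dim rl by (auto simp: g_def dest: idx_less split: if_splits)
    have gh: "g (h i) = i" if "i \<in> idx ?d {r, l'}" for i
      by (rule idx_ext[OF g_idx[OF h_idx[OF that]] that]) (use rl in \<open>auto simp: g_def h_def\<close>)
    have hg: "h (g i) = i" if "i \<in> idx ?d {r, l}" for i
      by (rule idx_ext[OF h_idx[OF g_idx[OF that]] that]) (use rl in \<open>auto simp: g_def h_def\<close>)
    have bij: "bij_betw h (idx ?d {r, l'}) (idx ?d {r, l})"
      by (rule bij_betwI[where g=g]) (auto simp: gh hg h_idx g_idx)
    have reindex: "(\<Sum>i\<in>idx ?d {r, l'}. \<Sum>j\<in>idx ?d {r, l'}. F (h i) (h j)) =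
        (\<Sum>i\<in>idx ?d {r, l}. \<Sum>j\<in>idx ?d {r, l}. F i j)" for F :: "'a opr"
      using sum.reindex_bij_betw[OF bij, of "\<lambda>i. \<Sum>j\<in>idx ?d {r, l}. F i j"]
      by (simp add: sum.reindex_bij_betw[OF bij, of "F _"])
    have amp: "ampliation ?d {l} {l'} r ?K P i j =
        (\<Sum>x<n. of_real (w x (i l') * w x (j l'))) * P (h i) (h j)"
      if ij: "i \<in> idx ?d {r, l'}" "j \<in> idx ?d {r, l'}" for i j
    proof -
      have "override_on (\<lambda>_\<in>{l}. i l') (restrict i {r}) {r} = h i" for i :: "'a midx"
        using rl by (auto simp: h_def override_on_def fun_eq_iff)
      moreover have "i l' < d l" "j l' < d l"
        using ij rl dim by (auto dest: idx_less[of _ _ _ l'])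
      moreover have "?d l = d l" "?d l' = d l'" using rl by auto
      ultimately show ?thesis
        using ij rl dim by (simp add: ampliation_apply pinch_def relabel_def block_def)
    qed
    have "(\<Sum>i\<in>idx ?d {r, l'}. \<Sum>j\<in>idx ?d {r, l'}. cnj (v i) * ampliation ?d {l} {l'} r ?K P i j * v j) \<in> \<real>\<^sub>\<ge>\<^sub>0"
      (is "?Q \<in> _") for v
    proof -
      \<comment> \<open>The adjoint of the \<open>x\<close>-th Kraus operator applied to
        \<open>v\<close>.\<close>
      let ?u = "\<lambda>x i. of_real (w x (i l)) * v (g i)"
      have "?Q = (\<Sum>i\<in>idx ?d {r, l'}. \<Sum>j\<in>idx ?d {r, l'}. \<Sum>x<n. cnj (?u x (h i)) * P (h i) (h j) * ?u x (h j))"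
      proof (intro sum.cong refl)
        fix i j assume ij: "i \<in> idx ?d {r, l'}" "j \<in> idx ?d {r, l'}"
        have "h i l = i l'" "h j l = j l'" using rl by (auto simp: h_def)
        then show "cnj (v i) * ampliation ?d {l} {l'} r ?K P i j * v j =
            (\<Sum>x<n. cnj (?u x (h i)) * P (h i) (h j) * ?u x (h j))"
          using ij by (simp add: amp gh sum_distrib_left sum_distrib_right ac_simps)
      qed
      also have "\<dots> = (\<Sum>x<n. \<Sum>i\<in>idx ?d {r, l'}. \<Sum>j\<in>idx ?d {r, l'}. cnj (?u x (h i)) * P (h i) (h j) * ?u x (h j))"
        by (subst sum.swap[of _ "{..<n}"], subst (2) sum.swap, rule refl)
      also have "\<dots> = (\<Sum>x<n. \<Sum>i\<in>idx ?d {r, l}. \<Sum>j\<in>idx ?d {r, l}. cnj (?u x i) * P i j * ?u x j)"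
        by (rule sum.cong[OF refl]) (rule reindex[of "\<lambda>i j. cnj (?u _ i) * P i j * ?u _ j"])
      also have "\<dots> \<in> \<real>\<^sub>\<ge>\<^sub>0"
        by (intro sum_nonneg_Reals) (rule P[unfolded psd_def, THEN conjunct2, THEN spec, of "?u _"])
      finally show ?thesis .
    qed
    moreover have "ampliation ?d {l} {l'} r ?K P \<in> ops ?d (insert r {l'})"
      using rl by (auto simp: lin_def ampliation_apply)
    ultimately show "psd ?d (insert r {l'}) (ampliation ?d {l} {l'} r ?K P)" by (simp add: psd_def)
  qed
  ultimately show ?thesis by (simp add: channel_def)
qed

text \<open>The two memories needed: the identity channel, and complete dephasing in the
  computational basis if \<open>cl\<close> (classical) holds.\<close>

definition memory_choi :: "('l \<Rightarrow> nat) \<Rightarrow> bool \<Rightarrow> 'l \<Rightarrow> 'l \<Rightarrow> 'l opr" where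
  "memory_choi d cl l l' = (\<lambda>i k. if i \<in> idx d {l, l'} \<and> k \<in> idx d {l, l'} \<and>
     i l = i l' \<and> k l = k l' \<and> (cl \<longrightarrow> i l = k l) then 1 else 0)"

lemma choi_pinch:
  assumes "l \<noteq> l'"
    and "\<And>e f. e < d l' \<Longrightarrow> f < d l' \<Longrightarrow> (\<Sum>x<n. w x e * w x f) = (if cl \<longrightarrow> e = f then 1 else 0)"
  shows "choi d {l} {l'} (pinch d n w l l') = memory_choi d cl l l'"
proof (intro ext)
  fix i j :: "'a midx"
  show "choi d {l} {l'} (pinch d n w l l') i j = memory_choi d cl l l' i j"
  proof (cases "i \<in> idx d {l, l'} \<and> j \<in> idx d {l, l'}")
    case True
    then have lt: "i l' < d l'" "j l' < d l'" by (auto dest: idx_less)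
    have r: "(\<lambda>_\<in>{l}. k l') = restrict k {l} \<longleftrightarrow> k l = k l'" for k :: "'a midx"
      by (simp add: fun_eq_iff) metis
    have "choi d {l} {l'} (pinch d n w l l') i j = of_real (\<Sum>x<n. w x (i l') * w x (j l')) *
        (if i l = i l' \<and> j l = j l' then 1 else 0)"
      using True lt by (simp add: choi_apply pinch_def relabel_def mat_unit_def r insert_commute)
    then show ?thesis using True assms(2)[OF lt] by (auto simp: memory_choi_def)
  next
    case False
    then show ?thesis by (auto simp: choi_apply memory_choi_def insert_commute)
  qed
qed

lemma memory_choi_channel:
  assumes "l \<noteq> l'" "d l = d l'"
  shows "channel_choi d {l} {l'} (memory_choi d cl l l')"
proof (cases cl)
  case True
  have "(\<Sum>x<d l. (if x = e then 1 else 0) * (if x = f then 1 else 0)) = (if e = f then 1 else 0 :: real)"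
    if "e < d l" for e f
  proof -
    have "(\<Sum>x<d l. (if x = e then 1 else 0) * (if x = f then 1 else 0)) =
      (\<Sum>x<d l. if x = e then if e = f then 1 else 0 else 0 :: real)" by (intro sum.cong) auto
    then show ?thesis using that by simp
  qed
  then show ?thesis unfolding channel_choi_def using assms True
    by (intro exI[of _ "pinch d (d l) (\<lambda>x e. if x = e then 1 else 0) l l'"] conjI channel_pinch choi_pinch[symmetric]) auto
next
  case False
  then show ?thesis unfolding channel_choi_def using assms
    by (intro exI[of _ "pinch d 1 (\<lambda>x e. 1) l l'"] conjI channel_pinch choi_pinch[symmetric]) auto
qed

lemma memory_choi_identity:
  assumes "l \<noteq> l'" "d l = d l'"
  shows "identity_choi d l l' (memory_choi d False l l')"
proof -
  have "pinch d 1 (\<lambda>x e. 1) l l' = relabel d l l'" by (intro ext) (simp add: pinch_def)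
  then show ?thesis using choi_pinch[where d=d and l=l and l'=l' and n=1 and w="\<lambda>x e. 1" and cl=False] assms by (simp add: identity_choi_def)
qed

text \<open>Complete dephasing measures in the computational basis and prepares the observed basis
  state, so the same projectors serve as states and as effects.\<close>

lemma memory_choi_entanglement_breaking:
  assumes "l \<noteq> l'" "d l = d l'"
  shows "entanglement_breaking_choi d l l' (memory_choi d True l l')"
proof -
  define D where "D = (\<lambda>m x i k. if i \<in> idx d {m} \<and> k \<in> idx d {m} \<and> i m = x \<and> k m = x then 1 else 0 :: complex)"
  have D: "psd d {m} (D m x)" for m x
    by (rule psd_rank_one[where z="\<lambda>i. if i m = x then 1 else 0"]) (simp add: D_def)
  have one: "(\<Sum>x<d m. D m x i k) = ident d {m} i k" for m i k
  proof (cases "i \<in> idx d {m} \<and> k \<in> idx d {m}")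
    case True
    then have "i = k \<longleftrightarrow> i m = k m" by (auto intro: idx_ext)
    moreover have "(\<Sum>x<d m. D m x i k) = (\<Sum>x<d m. if x = i m then if k m = i m then 1 else 0 else 0)"
      using True by (intro sum.cong) (auto simp: D_def)
    ultimately show ?thesis using True idx_less[of i d "{m}" m] by (auto simp: ident_def)
  next
    case False
    then show ?thesis by (auto simp: D_def ident_def)
  qed
  have "density d {l'} (D l' x)" if "x < d l" for x
  proof -
    have "trace d {l'} (D l' x) = (\<Sum>e<d l'. if e = x then 1 else 0)"
      unfolding trace_def sum_idx_singleton by (intro sum.cong) (auto simp: D_def)
    then show ?thesis using D that assms(2) by (simp add: density_def)
  qed
  moreover have "povm d {l} (d l) (D l)"
    using D one by (auto simp: povm_def fun_eq_iff)
  moreover have "memory_choi d True l l' i k = (\<Sum>x<d l. tensor d {l'} {l} (D l' x) (D l x) i k)" for i k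
  proof (cases "i \<in> idx d {l, l'} \<and> k \<in> idx d {l, l'}")
    case True
    then have "(\<Sum>x<d l. tensor d {l'} {l} (D l' x) (D l x) i k) =
        (\<Sum>x<d l. if x = i l then if i l' = i l \<and> k l = i l \<and> k l' = i l then 1 else 0 else 0)"
      by (intro sum.cong) (auto simp: tensor_def D_def insert_commute dest: idx_less)
    then show ?thesis using True idx_less[of i d "{l, l'}" l] by (auto simp: memory_choi_def)
  next
    case False
    then show ?thesis by (auto simp: memory_choi_def tensor_def insert_commute)
  qed
  ultimately show ?thesis unfolding entanglement_breaking_choi_def
    by - (rule exI[of _ "d l"], rule exI[of _ "D l'"], rule exI[of _ "D l"], auto intro!: ext)
qed

section \<open>The example processes\<close>

text \<open>Both forms of the successor occur in time labels, and labels match only in one normal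
  form.\<close>

declare Suc_eq_plus1 [symmetric, simp]

lemma link_single:
  assumes fin: "finite a" "finite b" and l: "a \<inter> b = {l}"
    and i: "i \<in> idx d (a \<union> b - a \<inter> b)" and j: "j \<in> idx d (a \<union> b - a \<inter> b)"
  shows "snd (link d (a, A) (b, B)) i j = (\<Sum>e<d l. \<Sum>f<d l.
    A (restrict (i(l := e)) a) (restrict (j(l := f)) a) * B (restrict (i(l := e)) b) (restrict (j(l := f)) b))"
proof -
  have m: "merge s {l} i (\<lambda>_\<in>{l}. e) = restrict (i(l := e)) s" for s i e
    by (auto simp: merge_def override_on_def fun_eq_iff)
  show ?thesis using i j
    by (simp only: link_apply[OF fin] simp_thms if_True) (simp only: l sum_idx_singleton m)
qed

text \<open>Evaluates a contraction of multiples of 0/1 matrices when the remaining indices determine the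
  contracted ones as \<open>x\<close> and \<open>y\<close>.\<close>

lemma link_indicator:
  fixes d :: "'l \<Rightarrow> nat" and c c' :: complex
  assumes fin: "finite a" "finite b" and l: "a \<inter> b = {l}"
    and i: "i \<in> idx d (a \<union> b - a \<inter> b)" and j: "j \<in> idx d (a \<union> b - a \<inter> b)"
    and A: "\<And>i j. i \<in> idx d a \<Longrightarrow> j \<in> idx d a \<Longrightarrow> A i j = (if P i j then c else 0)"
    and B: "\<And>i j. i \<in> idx d b \<Longrightarrow> j \<in> idx d b \<Longrightarrow> B i j = (if Q i j then c' else 0)"
    and E: "x < d l" "y < d l"
    and S: "\<And>e f. e < d l \<Longrightarrow> f < d l \<Longrightarrow>
      P (restrict (i(l := e)) a) (restrict (j(l := f)) a) \<and> Q (restrict (i(l := e)) b) (restrict (j(l := f)) b)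
      \<longleftrightarrow> e = x \<and> f = y \<and> S"
  shows "snd (link d (a, A) (b, B)) i j = (if S then c * c' else 0)"
proof -
  have mem: "restrict (i(l := e)) s \<in> idx d s" if "e < d l" "s = a \<or> s = b"
    "i \<in> idx d (a \<union> b - a \<inter> b)" for i e s
    using that l by (auto dest: idx_less)
  have "snd (link d (a, A) (b, B)) i j = (\<Sum>e<d l. \<Sum>f<d l. if e = x then if f = y then if S then c * c' else 0 else 0 else 0)"
    unfolding link_single[OF fin l i j]
  proof (intro sum.cong refl)
    fix e f assume "e \<in> {..<d l}" "f \<in> {..<d l}"
    then have ef: "e < d l" "f < d l" by auto
    have "A (restrict (i(l := e)) a) (restrict (j(l := f)) a) * B (restrict (i(l := e)) b) (restrict (j(l := f)) b) =
      (if P (restrict (i(l := e)) a) (restrict (j(l := f)) a) \<and> Q (restrict (i(l := e)) b) (restrict (j(l := f)) b)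
       then c * c' else 0)"
      unfolding A[OF mem[OF ef(1) disjI1[OF refl] i] mem[OF ef(2) disjI1[OF refl] j]]
        B[OF mem[OF ef(1) disjI2[OF refl] i] mem[OF ef(2) disjI2[OF refl] j]] by simp
    then show "A (restrict (i(l := e)) a) (restrict (j(l := f)) a) * B (restrict (i(l := e)) b) (restrict (j(l := f)) b)
      = (if e = x then if f = y then if S then c * c' else 0 else 0 else 0)"
      unfolding S[OF ef] by simp
  qed
  also have "\<dots> = (\<Sum>e<d l. if e = x then \<Sum>f<d l. if f = y then if S then c * c' else 0 else 0 else 0)"
    by (intro sum.cong) auto
  also have "\<dots> = (if S then c * c' else 0)" using E by simp
  finally show ?thesis .
qed

text \<open>Two example processes. In both, a memory bit \<open>i (SI 1) + i (SO 1)\<close> is carried by the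
  environment to the last step. If \<open>ent\<close> holds, then that bit comes from an initial state maximally
  entangled with \<open>SI 1\<close>, and it is output at \<open>SI N\<close>; the spaces \<open>SO j\<close> are trivial. Otherwise it comes
  from \<open>SO 1\<close>, controls a bit flip from \<open>SO (N - 1)\<close> to \<open>SI N\<close>, and is discarded.\<close>

definition ex_dim :: "nat \<Rightarrow> bool \<Rightarrow> label \<Rightarrow> nat" where
  "ex_dim N ent l = (case l of
     SI j \<Rightarrow> if j = N \<or> j = 1 \<and> ent then 2 else 1
   | SO j \<Rightarrow> if (j = 1 \<or> j = N - 1) \<and> \<not> ent then 2 else 1
   | EI j \<Rightarrow> if j = 1 \<and> \<not> ent \<or> j = N \<and> ent then 1 else 2
   | EO j \<Rightarrow> if j = 1 \<and> \<not> ent then 1 else 2)"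

text \<open>Before the last step at most one of the two inputs is nontrivial, so the sum is again a
  bit and stores that input in the memory. The last gate is a controlled bit flip, or moves the
  memory to the system if \<open>ent\<close> holds.\<close>

definition ex_gate :: "nat \<Rightarrow> bool \<Rightarrow> nat \<Rightarrow> nat \<times> nat \<Rightarrow> nat \<times> nat" where
  "ex_gate N ent j p = (if j = N - 1 then (if ent then 0 else fst p, (fst p + snd p) mod 2)
     else (fst p + snd p, 0))"

definition ex_unitary :: "nat \<Rightarrow> bool \<Rightarrow> nat \<Rightarrow> label opr" where
  "ex_unitary N ent j = choi (ex_dim N ent) {EO j, SO j} {EI (j + 1), SI (j + 1)}
     (\<lambda>A. let V = pair_perm (ex_dim N ent) (EO j) (SO j) (EI (j + 1)) (SI (j + 1)) (ex_gate N ent j)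
       in mult (ex_dim N ent) {EO j, SO j} (mult (ex_dim N ent) {EO j, SO j} V A) (adj V))"

definition ex_state :: "nat \<Rightarrow> bool \<Rightarrow> label opr" where
  "ex_state N ent = (\<lambda>i k. if i \<in> idx (ex_dim N ent) {EI 1, SI 1} \<and> k \<in> idx (ex_dim N ent) {EI 1, SI 1} \<and>
     i (EI 1) = i (SI 1) \<and> k (EI 1) = k (SI 1) then 1 / of_nat (ex_dim N ent (SI 1)) else 0)"

text \<open>For \<open>N >= 3\<close> one of \<open>SI 1\<close> and \<open>SO 1\<close> is
  one-dimensional, so the sum is a bit. At \<open>n = 1\<close> the label \<open>SO 1\<close> is not
  yet open and carries no value.\<close>

definition ex_bit :: "nat \<Rightarrow> label midx \<Rightarrow> nat" where
  "ex_bit n i = i (SI 1) + (if n = 1 then 0 else i (SO 1))"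

definition ex_out :: "nat \<Rightarrow> label midx \<Rightarrow> bool" where
  "ex_out N i \<longleftrightarrow> i (SI N) = (ex_bit N i + i (SO (N - 1))) mod 2"

text \<open>Discarding the control bit removes the coherences between its values, whence the last
  condition; under \<open>ent\<close> nothing is discarded.\<close>

definition ex_process :: "nat \<Rightarrow> bool \<Rightarrow> label opr" where
  "ex_process N ent = (\<lambda>i k. if i \<in> idx (ex_dim N ent) (sys N) \<and> k \<in> idx (ex_dim N ent) (sys N) \<and>
     ex_out N i \<and> ex_out N k \<and> (ent \<or> ex_bit N i = ex_bit N k)
     then 1 / of_nat (ex_dim N ent (SI 1)) else 0)"

lemma ex_dim_pos: "0 < ex_dim N ent l"
  by (simp add: ex_dim_def split: label.split)

text \<open>\<open>cl\<close> stays free so that one computation covers both memories; dephasing is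
  considered only for the signalling example.\<close>

context
  fixes N :: nat and ent cl :: bool and d :: "label \<Rightarrow> nat"
  assumes N: "3 \<le> N" and cl: "cl \<Longrightarrow> \<not> ent" and d: "d = ex_dim N ent"
begin

lemma d_simps:
  "d (SI j) = (if j = N \<or> j = 1 \<and> ent then 2 else 1)"
  "d (SO j) = (if (j = 1 \<or> j = N - 1) \<and> \<not> ent then 2 else 1)"
  "d (EI j) = (if j = 1 \<and> \<not> ent \<or> j = N \<and> ent then 1 else 2)"
  "d (EO j) = (if j = 1 \<and> \<not> ent then 1 else 2)"
  by (auto simp: d ex_dim_def)

lemma ex_gate_bij:
  assumes j: "j \<in> {1..<N}"
  shows "bij_betw (ex_gate N ent j) ({..<d (EO j)} \<times> {..<d (SO j)}) ({..<d (EI (j + 1))} \<times> {..<d (SI (j + 1))})"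
proof -
  have s: "{..<2} = {0, 1::nat}" "{..<1} = {0::nat}" by auto
  \<comment> \<open>By \<open>N >= 3\<close> the first step is never the last one.\<close>
  consider "j = N - 1" "j \<noteq> 1" | "j \<noteq> N - 1" "j = 1" | "j \<noteq> N - 1" "j \<noteq> 1" using N by linarith
  then show ?thesis
  proof cases
    case 1
    then have "j + 1 = N" using j by auto
    then show ?thesis using 1 N
      by (cases ent) (auto simp: bij_betw_def inj_on_def d_simps ex_gate_def s)
  next
    case 2
    then have "j + 1 \<noteq> N" using j by auto
    then show ?thesis using 2 N
      by (cases ent) (auto simp: bij_betw_def inj_on_def d_simps ex_gate_def s)
  next
    case 3
    then have "j + 1 \<noteq> N" "j + 1 \<noteq> 1" using j by auto
    then show ?thesis using 3 N
      by (auto simp: bij_betw_def inj_on_def d_simps ex_gate_def s)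
  qed
qed

lemma ex_unitary_choi:
  assumes j: "j \<in> {1..<N}"
  shows "unitary_choi d {EO j, SO j} {EI (j + 1), SI (j + 1)} (ex_unitary N ent j)"
  unfolding unitary_choi_def ex_unitary_def Let_def d[symmetric]
  using unitary_pair_perm[where d=d and l="EO j" and m="SO j" and l'="EI (j + 1)" and m'="SI (j + 1)",
      OF _ _ ex_gate_bij[OF j]] by blast

lemma ex_unitary_apply:
  assumes "i \<in> idx d (u_labels j)" "k \<in> idx d (u_labels j)"
  shows "ex_unitary N ent j i k =
    (if (i (EI (j + 1)), i (SI (j + 1))) = ex_gate N ent j (i (EO j), i (SO j)) \<and>
        (k (EI (j + 1)), k (SI (j + 1))) = ex_gate N ent j (k (EO j), k (SO j)) then 1 else 0)"
proof -
  have "{EO j, SO j} \<union> {EI (j + 1), SI (j + 1)} = u_labels j" by auto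
  moreover have "i (EI (j + 1)) < d (EI (j + 1))" "i (SI (j + 1)) < d (SI (j + 1))"
    "i (EO j) < d (EO j)" "i (SO j) < d (SO j)" if "i \<in> idx d (u_labels j)" for i
    using that by (auto dest: idx_less)
  ultimately show ?thesis
    unfolding ex_unitary_def Let_def d[symmetric] using assms
    by (subst unitary_conj_choi_apply) (auto simp: pair_perm_def)
qed

lemma ex_step:
  assumes j: "j \<in> {1..<N}" and i: "i \<in> idx d (t_labels j)" and k: "k \<in> idx d (t_labels j)"
  shows "step_op d (ex_unitary N ent) (\<lambda>j. memory_choi d cl (EI j) (EO j)) j i k =
    (if (i (EI (j + 1)), i (SI (j + 1))) = ex_gate N ent j (i (EI j), i (SO j)) \<and>
        (k (EI (j + 1)), k (SI (j + 1))) = ex_gate N ent j (k (EI j), k (SO j)) \<and>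
        (cl \<longrightarrow> i (EI j) = k (EI j)) then 1 else 0)"
proof -
  have dd: "d (EI j) = d (EO j)" using j by (auto simp: d_simps)
  have lt: "i (EI j) < d (EO j)" "k (EI j) < d (EO j)" using i k by (auto simp: dd[symmetric] dest: idx_less)
  let ?S = "(i (EI (j + 1)), i (SI (j + 1))) = ex_gate N ent j (i (EI j), i (SO j)) \<and>
    (k (EI (j + 1)), k (SI (j + 1))) = ex_gate N ent j (k (EI j), k (SO j)) \<and> (cl \<longrightarrow> i (EI j) = k (EI j))"
  have M: "memory_choi d cl (EI j) (EO j) i k = (if i (EI j) = i (EO j) \<and> k (EI j) = k (EO j) \<and>
      (cl \<longrightarrow> i (EI j) = k (EI j)) then 1 else 0)"
    if "i \<in> idx d {EO j, EI j}" "k \<in> idx d {EO j, EI j}" for i k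
    using that by (simp add: memory_choi_def insert_commute)
  have "step_op d (ex_unitary N ent) (\<lambda>j. memory_choi d cl (EI j) (EO j)) j i k = (if ?S then 1 * 1 else 0)"
    unfolding step_op_def
  \<comment> \<open>Both memories preserve the basis index, so the contracted \<open>EO j\<close>
    carries the value at \<open>EI j\<close>.\<close>
  proof (rule link_indicator[where x="i (EI j)" and y="k (EI j)", OF _ _ u_labels_Int _ _ ex_unitary_apply M], goal_cases)
    case 3 show ?case using i unfolding u_labels_diff .
  next
    case 4 show ?case using k unfolding u_labels_diff .
  next
    case (11 e f) then show ?case using lt by auto
  qed (use lt in auto)
  then show ?thesis by simp
qed

lemma ex_bit_less: "i \<in> idx d a \<Longrightarrow> SI 1 \<in> a \<Longrightarrow> n = 1 \<or> SO 1 \<in> a \<Longrightarrow> n < N \<Longrightarrow> ex_bit n i < d (EI n)"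
  using idx_less[of i d a "SI 1"] idx_less[of i d a "SO 1"] N
  by (auto simp: ex_bit_def d_simps split: if_splits)

abbreviation ex_stage :: "nat \<Rightarrow> label opr" where
  "ex_stage \<equiv> stage_op d (ex_unitary N ent) (\<lambda>j. memory_choi d cl (EI j) (EO j)) (ex_state N ent)"

text \<open>The environment stores the bit. The threshold \<open>2 < n\<close> arises because the
  control bit enters through \<open>SO 1\<close> after the memory operation of time
  \<open>1\<close>, so it is first dephased at time \<open>2\<close>, that is, in stage
  \<open>3\<close>.\<close>

lemma ex_stage_apply:
  assumes "1 \<le> n" "n < N" and "i \<in> idx d (stage n)" "k \<in> idx d (stage n)"
  shows "ex_stage n i k =
    (if i (EI n) = ex_bit n i \<and> k (EI n) = ex_bit n k \<and> (cl \<and> 2 < n \<longrightarrow> ex_bit n i = ex_bit n k)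
     then 1 / of_nat (d (SI 1)) else 0)"
  using assms
proof (induction n arbitrary: i k rule: dec_induct)
  case base
  then show ?case by (simp add: ex_state_def d[symmetric] stage_1[symmetric] ex_bit_def)
next
  case (step n)
  let ?b = "ex_bit n" and ?b' = "ex_bit (Suc n)"
  have n: "1 \<le> n" "n \<noteq> 0" "n \<in> {1..<N}" "n < N" "n \<noteq> N - 1" using step by auto
  have dom: "t_labels n \<union> stage n - t_labels n \<inter> stage n = stage (Suc n)" by (rule t_labels_diff[OF n(1)])
  \<comment> \<open>Before the last step \<open>SI (Suc n)\<close> is trivial, and so is
    \<open>SO n\<close> unless \<open>n = 1\<close>; the bit changes only when it enters.\<close>
  have bit: "?b' i = ?b i + i (SO n) \<and> i (SI (Suc n)) = 0 \<and> (n \<noteq> 1 \<longrightarrow> i (SO n) = 0)" if i: "i \<in> idx d (stage (Suc n))" for i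
  proof -
    have "i (SO n) < d (SO n)" "i (SI (Suc n)) < d (SI (Suc n))"
      using n i by (auto intro!: idx_less[OF i])
    then show ?thesis using n step.prems(1) by (auto simp: ex_bit_def d_simps One_nat_def split: if_splits)
  qed
  \<comment> \<open>Under \<open>cl\<close> the space \<open>SI 1\<close> is trivial, so the bit is
    still \<open>0\<close> at time \<open>1\<close> and dephasing imposes no condition
    there.\<close>
  have one: "?b i = 0" if i: "i \<in> idx d (stage (Suc n))" "cl" "n = 1" for i
    using idx_less[OF i(1), of "SI 1"] cl[OF i(2)] i(3) N by (auto simp: ex_bit_def d_simps)
  have upd: "?b (\<lambda>a. if a \<in> stage n then (i(EI n := e)) a else undefined) = ?b i" for i e
    using n by (auto simp: ex_bit_def)
  have lt: "?b i < d (EI n)" if "i \<in> idx d (stage (Suc n))" for i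
    using that n by (intro ex_bit_less) auto
  have gate: "ex_gate N ent n p = (fst p + snd p, 0)" for p using n by (simp add: ex_gate_def)
  have "snd (link d (t_labels n, step_op d (ex_unitary N ent) (\<lambda>j. memory_choi d cl (EI j) (EO j)) n)
      (stage n, ex_stage n)) i k =
    (if i (EI (Suc n)) = ?b' i \<and> k (EI (Suc n)) = ?b' k \<and> (cl \<and> 2 < Suc n \<longrightarrow> ?b' i = ?b' k)
     then 1 * (1 / of_nat (d (SI 1))) else 0)"
  proof (rule link_indicator[where x="?b i" and y="?b k",
        OF _ _ t_labels_Int _ _ ex_step[OF n(3)] step.IH[OF n(4)]], goal_cases)
    case 3 show ?case unfolding dom using step.prems by auto
  next
    case 4 show ?case unfolding dom using step.prems by auto
  next
    case 9 show ?case using lt step.prems by auto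
  next
    case 10 show ?case using lt step.prems by auto
  next
    case (11 e f)
    show ?case using bit[OF step.prems(2)] bit[OF step.prems(3)] one[OF step.prems(2)] one[OF step.prems(3)]
      n(1)
      by (simp add: gate upd restrict_def) (cases "n = 1"; auto)
  qed auto
  then show ?case unfolding mult_1_left using n by (simp del: link.simps split del: if_split)
qed

text \<open>The last gate has its own form. Since \<open>N - 1 >= 2\<close>, the control bit has
  entered before, and dephasing at time \<open>N - 1\<close> reaches it even for
  \<open>N = 3\<close>.\<close>

lemma ex_stage_last:
  assumes ik: "i \<in> idx d (stage N)" "k \<in> idx d (stage N)"
  shows "ex_stage N i k =
    (if i (EI N) = (if ent then 0 else ex_bit N i) \<and> k (EI N) = (if ent then 0 else ex_bit N k) \<and>
        ex_out N i \<and> ex_out N k \<and> (cl \<longrightarrow> ex_bit N i = ex_bit N k)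
     then 1 / of_nat (d (SI 1)) else 0)"
proof -
  obtain n where Nn: "N = Suc n" using N by (cases N) auto
  let ?b = "ex_bit N"
  have n: "1 \<le> n" "n \<noteq> 0" "n \<noteq> 1" "n \<in> {1..<N}" "n < N" "n = N - 1" using N Nn by auto
  have dom: "t_labels n \<union> stage n - t_labels n \<inter> stage n = stage N"
    unfolding Nn by (rule t_labels_diff[OF n(1)])
  have bn: "ex_bit n i = ?b i" for i using n N by (simp add: ex_bit_def)
  have upd: "?b (\<lambda>a. if a \<in> stage n then (i(EI n := e)) a else undefined) = ?b i" for i e
    using n by (auto simp: ex_bit_def)
  have lt: "?b i < d (EI n)" if "i \<in> idx d (stage N)" for i
    unfolding bn[symmetric] by (rule ex_bit_less[OF that]) (use n N in auto)
  have gate: "ex_gate N ent n p = (if ent then 0 else fst p, (fst p + snd p) mod 2)" for p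
    using n by (simp add: ex_gate_def)
  have "snd (link d (t_labels n, step_op d (ex_unitary N ent) (\<lambda>j. memory_choi d cl (EI j) (EO j)) n)
      (stage n, ex_stage n)) i k =
    (if i (EI N) = (if ent then 0 else ?b i) \<and> k (EI N) = (if ent then 0 else ?b k) \<and>
        ex_out N i \<and> ex_out N k \<and> (cl \<longrightarrow> ?b i = ?b k)
     then 1 * (1 / of_nat (d (SI 1))) else 0)"
  proof (rule link_indicator[where x="?b i" and y="?b k",
        OF _ _ t_labels_Int _ _ ex_step[OF n(4)] ex_stage_apply[OF n(1,5)]], goal_cases)
    case 3 show ?case unfolding dom by (rule ik)
  next
    case 4 show ?case unfolding dom by (rule ik)
  next
    case 9 show ?case using lt ik by auto
  next
    case 10 show ?case using lt ik by auto
  next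
    case (11 e f)
    have "n + 1 = N" "N - 1 = n" "EI n \<noteq> EI N" "SO n \<in> t_labels n" using n by auto
    then show ?case by (simp add: gate upd bn restrict_def ex_out_def split del: if_split) auto
  qed auto
  moreover have "ex_stage N = snd (link d (t_labels n, step_op d (ex_unitary N ent)
      (\<lambda>j. memory_choi d cl (EI j) (EO j)) n) (stage n, ex_stage n))"
    using stage_op.simps(2)[of d "ex_unitary N ent" _ "ex_state N ent" n] n(2) Nn by (simp del: link.simps)
  ultimately show ?thesis by (simp only: mult_1_left)
qed

text \<open>If \<open>ent\<close> fails, tracing out \<open>EI N\<close> equates the bit in row and
  column whether or not \<open>cl\<close> holds; if \<open>ent\<close> holds, \<open>EI N\<close> is
  trivial. Hence the result does not depend on \<open>cl\<close>.\<close>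

lemma ex_process_form:
  "process_form N d (\<lambda>j. memory_choi d cl (EI j) (EO j)) (ex_process N ent)"
proof -
  have N1: "1 \<le> N" using N by simp
  have rho: "density d {EI 1, SI 1} (ex_state N ent)"
  proof -
    have "psd d {EI 1, SI 1} (ex_state N ent)"
      by (rule psd_rank_one[where z="\<lambda>i. if i (EI 1) = i (SI 1) then 1 / of_real (sqrt (d (SI 1))) else 0"])
        (auto simp: ex_state_def d simp flip: of_real_mult)
    moreover have "trace d {EI 1, SI 1} (ex_state N ent) =
        (\<Sum>i\<in>idx d {EI 1, SI 1}. (\<lambda>p. if fst p = snd p then 1 / of_nat (d (SI 1)) else 0) (i (EI 1), i (SI 1)))"
      unfolding trace_def by (intro sum.cong refl) (auto simp: ex_state_def d)
    moreover have "\<dots> = 1"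
    proof -
      have s: "{..<2} = {0, 1::nat}" "{..<1} = {0::nat}" by auto
      show ?thesis
        by (subst sum_idx_pair) (use N in \<open>auto simp: sum.cartesian_product[symmetric] d_simps s\<close>)
    qed
    ultimately show ?thesis by (simp add: density_def)
  qed
  have "ex_process N ent i k = snd (link d ({EI N}, ident d {EI N}) (stage N, ex_stage N)) i k" for i k
  proof (cases "i \<in> idx d (sys N) \<and> k \<in> idx d (sys N)")
    case True
    let ?e = "\<lambda>i. if ent then 0 else ex_bit N i"
    let ?S = "ex_out N i \<and> ex_out N k \<and> (ent \<or> ex_bit N i = ex_bit N k)"
    have I: "ident d {EI N} i k = (if i (EI N) = k (EI N) then 1 else 0)"
      if "i \<in> idx d {EI N}" "k \<in> idx d {EI N}" for i k
      using that by (auto simp: ident_def intro: idx_ext)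
    have upd: "ex_bit N (\<lambda>a. if a \<in> stage N then (i(EI N := e)) a else undefined) = ex_bit N i"
      "ex_out N (\<lambda>a. if a \<in> stage N then (i(EI N := e)) a else undefined) = ex_out N i" for i e
      using N by (auto simp: ex_bit_def ex_out_def)
    have lt: "?e i < d (EI N)" if "i \<in> idx d (sys N)" for i
      using idx_less[OF that, of "SI 1"] idx_less[OF that, of "SO 1"] N
      by (auto simp: ex_bit_def d_simps split: if_splits)
    have "snd (link d ({EI N}, ident d {EI N}) (stage N, ex_stage N)) i k =
      (if ?S then 1 * (1 / of_nat (d (SI 1))) else 0)"
    proof (rule link_indicator[where x="?e i" and y="?e k" and l="EI N", OF _ _ _ _ _ I ex_stage_last], goal_cases)
      case 4 show ?case unfolding stage_final using True by auto
    next
      case 5 show ?case unfolding stage_final using True by auto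
    next
      case 10 show ?case using lt True by auto
    next
      case 11 show ?case using lt True by auto
    next
      case (12 e f)
      then show ?case using cl by (cases ent; simp add: upd restrict_def; auto)
    qed auto
    moreover have "ex_process N ent i k = (if ?S then 1 * (1 / of_nat (d (SI 1))) else 0)"
      using True by (auto simp: ex_process_def d)
    ultimately show ?thesis by (simp only:)
  next
    case False
    then show ?thesis unfolding link_apply[OF finite.insertI[OF finite.emptyI] finite_stage] stage_final
      by (auto simp: ex_process_def d)
  qed
  then have "ex_process N ent = snd (link d ({EI N}, ident d {EI N}) (stage N, ex_stage N))" by blast
  moreover have "channel_choi d {EI j} {EO j} (memory_choi d cl (EI j) (EO j))" if "j \<in> {1..<N}" for j
    using that by (intro memory_choi_channel) (auto simp: d_simps)
  ultimately show ?thesis unfolding process_form_iff[OF N1] using rho ex_unitary_choi by blast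
qed

end

section \<open>Membership of the examples\<close>

lemma ex_process_QM:
  assumes "3 \<le> N"
  shows "(ex_dim N ent, ex_process N ent) \<in> QM N"
proof -
  have "identity_choi (ex_dim N ent) (EI j) (EO j) (memory_choi (ex_dim N ent) False (EI j) (EO j))"
    if "j \<in> {1..<N}" for j
    using that by (intro memory_choi_identity) (auto simp: ex_dim_def)
  moreover have "env_choice (ex_dim N ent) (ex_dim N ent)" by (simp add: env_choice_def ex_dim_pos)
  moreover have "process_form N (ex_dim N ent) (\<lambda>j. memory_choi (ex_dim N ent) False (EI j) (EO j)) (ex_process N ent)"
    using assms by (intro ex_process_form) auto
  ultimately show ?thesis unfolding QM_def by blast
qed

lemma ex_process_CM:
  assumes "3 \<le> N"
  shows "(ex_dim N False, ex_process N False) \<in> CM N"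
proof -
  have "entanglement_breaking_choi (ex_dim N False) (EI j) (EO j) (memory_choi (ex_dim N False) True (EI j) (EO j))"
    if "j \<in> {1..<N}" for j
    using that by (intro memory_choi_entanglement_breaking) (auto simp: ex_dim_def)
  moreover have "env_choice (ex_dim N False) (ex_dim N False)" by (simp add: env_choice_def ex_dim_pos)
  moreover have "process_form N (ex_dim N False) (\<lambda>j. memory_choi (ex_dim N False) True (EI j) (EO j)) (ex_process N False)"
    using assms by (intro ex_process_form) auto
  ultimately show ?thesis unfolding CM_def by blast
qed

section \<open>Partial traces and the non-signalling condition entrywise\<close>

lemma ptrace_single:
  assumes "i \<in> idx d (a - {l})" "j \<in> idx d (a - {l})"
  shows "ptrace d a {l} A i j = (\<Sum>e<d l. A (i(l := e)) (j(l := e)))"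
proof -
  have "override_on i (\<lambda>_\<in>{l}. e) {l} = i(l := e)" for i :: "'a midx" and e
    by (auto simp: override_on_def fun_eq_iff)
  then show ?thesis using assms by (simp add: ptrace_def sum_idx_singleton)
qed

lemma ptrace_pair:
  assumes "l \<noteq> m" "i \<in> idx d (a - {l, m})" "j \<in> idx d (a - {l, m})"
  shows "ptrace d a {l, m} A i j = (\<Sum>e<d l. \<Sum>f<d m. A (i(l := e, m := f)) (j(l := e, m := f)))"
proof -
  have "override_on i ((\<lambda>_\<in>{m}. f)(l := e)) {l, m} = i(l := e, m := f)" for i :: "'a midx" and e f
    using assms(1) by (auto simp: override_on_def fun_eq_iff)
  then show ?thesis using assms by (simp add: ptrace_def sum_idx_insert sum_idx_singleton)
qed

lemma NS_right_apply:
  assumes k: "k \<in> {2..N}"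
    and i: "i \<in> idx d (sys N - {SI k})" and j: "j \<in> idx d (sys N - {SI k})"
  shows "tensor d {SO (k - 1)} (sys N - {SI k, SO (k - 1)})
       (\<lambda>i j. ident d {SO (k - 1)} i j / of_nat (d (SO (k - 1))))
       (ptrace d (sys N) {SI k, SO (k - 1)} C) i j =
    (if i (SO (k - 1)) = j (SO (k - 1)) then (\<Sum>e<d (SI k). \<Sum>f<d (SO (k - 1)).
       C (i(SI k := e, SO (k - 1) := f)) (j(SI k := e, SO (k - 1) := f))) / of_nat (d (SO (k - 1))) else 0)"
proof -
  let ?o = "SO (k - 1)" and ?r = "sys N - {SI k, SO (k - 1)}"
  have o: "?o \<in> sys N" "?o \<noteq> SI k" using k by auto
  then have set: "{?o} \<union> ?r = sys N - {SI k}" by auto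
  have r: "restrict i ?r \<in> idx d ?r" if "i \<in> idx d (sys N - {SI k})" for i
    using that by (auto dest: idx_less)
  have "(restrict i ?r)(SI k := e, ?o := f) = i(SI k := e, ?o := f)" if "i \<in> idx d (sys N - {SI k})" for i e f
    using that by (auto simp: fun_eq_iff idx_undefined)
  then have p: "ptrace d (sys N) {SI k, ?o} C (restrict i ?r) (restrict j ?r) =
      (\<Sum>e<d (SI k). \<Sum>f<d ?o. C (i(SI k := e, ?o := f)) (j(SI k := e, ?o := f)))"
    using ptrace_pair[OF o(2)[symmetric] r[OF i] r[OF j], of C] i j by simp
  have "restrict i {?o} = restrict j {?o} \<longleftrightarrow> i ?o = j ?o" by (simp add: fun_eq_iff)
  moreover have "restrict i {?o} \<in> idx d {?o}" using idx_less[OF i, of ?o] o by auto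
  ultimately show ?thesis using i j unfolding tensor_def set p by (simp add: ident_def)
qed

text \<open>One-dimensional spaces carry no signal: tracing them out and tensoring with their
  normalized identity changes nothing.\<close>

lemma trivial_outputs_NS:
  assumes C: "(d, C) \<in> QM N" and d: "\<And>j. j \<in> {1..<N} \<Longrightarrow> d (SO j) = 1"
  shows "(d, C) \<in> NS N"
proof -
  have "ptrace d (sys N) {SI k} C i j = tensor d {SO (k - 1)} (sys N - {SI k, SO (k - 1)})
      (\<lambda>i j. ident d {SO (k - 1)} i j / of_nat (d (SO (k - 1))))
      (ptrace d (sys N) {SI k, SO (k - 1)} C) i j" if k: "k \<in> {2..N}" for k i j
  proof (cases "i \<in> idx d (sys N - {SI k}) \<and> j \<in> idx d (sys N - {SI k})")
    case True
    then have ij: "i \<in> idx d (sys N - {SI k})" "j \<in> idx d (sys N - {SI k})" by auto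
    have one: "d (SO (k - 1)) = 1" using k by (intro d) auto
    have k1: "1 \<le> k - 1" "k - 1 < N" using k unfolding atLeastAtMost_iff by linarith+
    have z: "i (SO (k - 1)) = 0" if "i \<in> idx d (sys N - {SI k})" for i
      using idx_less[OF that, of "SO (k - 1)"] k k1 one by auto
    then have "i(SI k := e, SO (k - 1) := 0) = i(SI k := e)" if "i \<in> idx d (sys N - {SI k})" for i e
      using that by (auto simp: fun_eq_iff)
    moreover have "{..<1} = {0::nat}" by auto
    ultimately show ?thesis unfolding NS_right_apply[OF k ij] ptrace_single[OF ij] unfolding one
      using ij z[OF ij(1)] z[OF ij(2)] by simp
  next
    case False
    moreover have "{SO (k - 1)} \<union> (sys N - {SI k, SO (k - 1)}) = sys N - {SI k}" using k by auto
    ultimately show ?thesis by (auto simp: ptrace_def tensor_def)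
  qed
  then show ?thesis using C unfolding NS_def by blast
qed

text \<open>The violated equation is the one for \<open>k = 2\<close>: tracing out
  \<open>SI 2\<close>, which differs from \<open>SI N\<close>, keeps the dependence of
  \<open>SI N\<close> on \<open>SO 1\<close>.\<close>

lemma ex_process_not_NS:
  assumes N: "3 \<le> N"
  shows "(ex_dim N False, ex_process N False) \<notin> NS N"
proof
  let ?d = "ex_dim N False" and ?C = "ex_process N False"
  assume "(?d, ?C) \<in> NS N"
  moreover have k: "2 \<in> {2..N}" using N by simp
  ultimately have eq: "ptrace ?d (sys N) {SI 2} ?C = tensor ?d {SO (2 - 1)} (sys N - {SI 2, SO (2 - 1)})
      (\<lambda>i j. ident ?d {SO (2 - 1)} i j / of_nat (?d (SO (2 - 1))))
      (ptrace ?d (sys N) {SI 2, SO (2 - 1)} ?C)"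
    unfolding NS_def by blast
  \<comment> \<open>A forbidden index: \<open>SI N\<close> is \<open>1\<close> although
    \<open>SO 1\<close> and \<open>SO (N - 1)\<close> are \<open>0\<close>. The left side vanishes
    there, while averaging over \<open>SO 1\<close> gives \<open>1 / 2\<close>.\<close>
  define m where "m = (\<lambda>x\<in>sys N - {SI 2}. if x = SI N then 1 else 0 :: nat)"
  have m: "m \<in> idx ?d (sys N - {SI 2})" by (auto simp: m_def ex_dim_pos) (simp add: ex_dim_def)
  have one: "{..<1} = {0::nat}" "{..<2} = {0, 1::nat}" by auto
  have d: "?d (SI 2) = 1" "?d (SO 1) = 2" "?d (SI 1) = 1" using N by (auto simp: ex_dim_def)
  have mv: "m (SI N) = 1" "m (SI 1) = 0" "m (SO 1) = 0" "m (SO (N - 1)) = 0"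
    using N by (auto simp: m_def)
  have mem: "m(SI 2 := 0) \<in> idx ?d (sys N)" "m(SI 2 := 0, SO 1 := f) \<in> idx ?d (sys N)" if "f < 2" for f
    using m N that d by (auto simp: idx_def PiE_def extensional_def Pi_def)
  have "ptrace ?d (sys N) {SI 2} ?C m m = 0"
    unfolding ptrace_single[OF m m] using N mv
    by (auto simp: ex_process_def ex_out_def ex_bit_def d one)
  moreover have "ptrace ?d (sys N) {SI 2} ?C m m = 1 / 2"
  proof -
    have "?C (m(SI 2 := 0, SO 1 := f)) (m(SI 2 := 0, SO 1 := f)) = of_nat f" if "f < 2" for f
      using N mv mem[OF that] that by (auto simp: ex_process_def ex_out_def ex_bit_def d less_2_cases_iff)
    moreover have two: "2 - 1 = (1 :: nat)" by (simp add: One_nat_def)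
    ultimately show ?thesis unfolding eq NS_right_apply[OF k m m] unfolding two by (simp add: d one)
  qed
  ultimately show False by simp
qed

text \<open>Conditioned on the value \<open>x\<close> of the control bit the process is a product:
  the first factor fixes \<open>SO 1\<close> to \<open>x\<close>, the last one flips its input
  according to \<open>x\<close>, and the others are trivial.\<close>

lemma ex_process_SEP:
  assumes N: "3 \<le> N"
  shows "(ex_dim N False, ex_process N False) \<in> SEP N"
proof -
  let ?d = "ex_dim N False"
  define g where "g = (\<lambda>x j (i :: label midx). (j = 1 \<longrightarrow> i (SO 1) = x) \<and> (j = N - 1 \<longrightarrow> i (SI N) = (x + i (SO (N - 1))) mod 2))"
  \<comment> \<open>The value \<open>2\<close> compensates the uniform weights \<open>1 / 2\<close>;
    the factors of a separable process have to be positive but not normalized.\<close>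
  define \<rho> where "\<rho> = (\<lambda>i k. if i \<in> idx ?d {SI 1} \<and> k \<in> idx ?d {SI 1} then 2 else 0 :: complex)"
  define L where "L = (\<lambda>x j i k. if i \<in> idx ?d {SI (j + 1), SO j} \<and> k \<in> idx ?d {SI (j + 1), SO j} \<and>
    g x j i \<and> g x j k then 1 else 0 :: complex)"
  have fold: "fold (\<lambda>j. ltensor ?d ({SI (j + 1), SO j}, L x j)) [1..<n] ({SI 1}, \<rho>) =
      (sys n, \<lambda>i k. if i \<in> idx ?d (sys n) \<and> k \<in> idx ?d (sys n) \<and> (\<forall>j\<in>{1..<n}. g x j i \<and> g x j k) then 2 else 0)"
    if "1 \<le> n" for n x
    using that
  proof (induction n rule: dec_induct)
    case base
    have "sys 1 = {SI 1}" by (auto simp: sys_def)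
    then show ?case by (simp add: \<rho>_def)
  next
    case (step n)
    let ?R = "\<lambda>i k. if i \<in> idx ?d (sys n) \<and> k \<in> idx ?d (sys n) \<and> (\<forall>j\<in>{1..<n}. g x j i \<and> g x j k) then 2 else 0 :: complex"
    have set: "{SI (n + 1), SO n} \<union> sys n = sys (Suc n)" using sys_Suc[OF step(1)] by simp
    have g1: "g x n (restrict i {SI (Suc n), SO n}) = g x n i" for i
      using N by (auto simp: g_def)
    have g2: "g x j (restrict i (sys n)) = g x j i" if "j \<in> {1..<n}" for i j
      using N that by (auto simp: g_def)
    have "tensor ?d {SI (n + 1), SO n} (sys n) (L x n) ?R =
        (\<lambda>i k. if i \<in> idx ?d (sys (Suc n)) \<and> k \<in> idx ?d (sys (Suc n)) \<and>
          (\<forall>j\<in>{1..<Suc n}. g x j i \<and> g x j k) then 2 else 0)"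
    proof (intro ext)
      fix i k :: "label midx"
      have "restrict i {SI (n + 1), SO n} \<in> idx ?d {SI (n + 1), SO n}" "restrict i (sys n) \<in> idx ?d (sys n)"
        if "i \<in> idx ?d (sys (Suc n))" for i
        using that unfolding set[symmetric] restrict_idx_iff by (auto dest: idx_less)
      moreover have "{1..<Suc n} = insert n {1..<n}" using step by auto
      ultimately show "tensor ?d {SI (n + 1), SO n} (sys n) (L x n) ?R i k =
        (if i \<in> idx ?d (sys (Suc n)) \<and> k \<in> idx ?d (sys (Suc n)) \<and>
          (\<forall>j\<in>{1..<Suc n}. g x j i \<and> g x j k) then 2 else 0)"
        unfolding tensor_def set L_def by (auto simp: g1 g2 simp del: restrict_idx_iff)
    qed
    moreover have "[1..<Suc n] = [1..<n] @ [n]" using step by simp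
    ultimately show ?case using step set by simp
  qed
  have N1: "1 \<le> N" using N by simp
  have all_g: "(\<forall>j\<in>{1..<N}. g x j i) \<longleftrightarrow> i (SO 1) = x \<and> i (SI N) = (x + i (SO (N - 1))) mod 2" for x i
  proof
    assume a: "\<forall>j\<in>{1..<N}. g x j i"
    have "g x 1 i" "g x (N - 1) i" using a N by auto
    then show "i (SO 1) = x \<and> i (SI N) = (x + i (SO (N - 1))) mod 2" by (simp add: g_def)
  qed (auto simp: g_def)
  have C: "ex_process N False = (\<lambda>i k. \<Sum>x<2. of_real (1 / 2) *
      snd (fold (\<lambda>j. ltensor ?d ({SI (j + 1), SO j}, L x j)) [1..<N] ({SI 1}, \<rho>)) i k)"
  proof (intro ext)
    fix i k
    show "ex_process N False i k = (\<Sum>x<2. of_real (1 / 2) *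
      snd (fold (\<lambda>j. ltensor ?d ({SI (j + 1), SO j}, L x j)) [1..<N] ({SI 1}, \<rho>)) i k)"
    proof (cases "i \<in> idx ?d (sys N) \<and> k \<in> idx ?d (sys N)")
      case True
      have b: "ex_bit N i = i (SO 1) \<and> i (SO 1) < 2" if "i \<in> idx ?d (sys N)" for i
        using idx_less[OF that, of "SI 1"] idx_less[OF that, of "SO 1"] N
        by (auto simp: ex_bit_def ex_dim_def)
      \<comment> \<open>Only \<open>x = i (SO 1)\<close> contributes, and it requires the same value
        in \<open>k\<close>, which is the dephasing condition of \<open>ex_process\<close>.\<close>
      have "(\<Sum>x<2. of_real (1 / 2) *
          snd (fold (\<lambda>j. ltensor ?d ({SI (j + 1), SO j}, L x j)) [1..<N] ({SI 1}, \<rho>)) i k) =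
        (\<Sum>x<2. if x = i (SO 1) then if ex_out N i \<and> ex_out N k \<and> k (SO 1) = i (SO 1) then 1 else 0 else 0)"
        unfolding fold[OF N1] snd_conv using True all_g b
        by (intro sum.cong refl) (auto simp: ball_conj_distrib ex_out_def)
      then show ?thesis using True b N by (auto simp: ex_process_def ex_dim_def)
    next
      case False
      then show ?thesis unfolding fold[OF N1] snd_conv by (auto simp: ex_process_def)
    qed
  qed
  have "psd ?d {SI 1} \<rho>"
    by (rule psd_rank_one[where z="\<lambda>i. of_real (sqrt 2)"]) (simp add: \<rho>_def flip: of_real_mult)
  moreover have "psd ?d {SI (j + 1), SO j} (L x j)" for x j
    by (rule psd_rank_one[where z="\<lambda>i. if g x j i then 1 else 0"]) (simp add: L_def)
  ultimately have "\<exists>(n::nat) p L \<rho>. (\<forall>x<n. 0 \<le> p x) \<and> (\<Sum>x<n. p x) = (1::real) \<and>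
     (\<forall>x<n. psd ?d {SI 1} (\<rho> x)) \<and>
     (\<forall>x<n. \<forall>j\<in>{1..<N}. psd ?d {SI (j + 1), SO j} (L x j)) \<and>
     ex_process N False = (\<lambda>i k. \<Sum>x<n. of_real (p x) *
       snd (fold (\<lambda>j. ltensor ?d ({SI (j + 1), SO j}, L x j)) [1..<N] ({SI 1}, \<rho> x)) i k)"
    using C by (intro exI[of _ 2] exI[of _ "\<lambda>_. 1 / 2 :: real"] exI[of _ L] exI[of _ "\<lambda>_. \<rho>"]) auto
  then show ?thesis using ex_process_QM[OF N, of False] unfolding SEP_def by blast
qed

text \<open>Only system dimensions are fixed, because a classical-memory representation brings its
  own environment. The entry between all zeros and \<open>SI 1 = SI N = 1\<close> is a coherence of
  the entangled state, but the exchange at \<open>SI 1\<close> leads to \<open>SI 1 = 1\<close>,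
  \<open>SI N = 0\<close>, where the diagonal vanishes.\<close>

lemma ex_process_not_product_gram:
  assumes N: "3 \<le> N" and d: "\<And>j. d (SI j) = ex_dim N True (SI j)" "\<And>j. d (SO j) = ex_dim N True (SO j)"
  shows "\<not> gram d (sys N) (product_at d (sys N) (SI 1)) (ex_process N True)"
proof
  assume g: "gram d (sys N) (product_at d (sys N) (SI 1)) (ex_process N True)"
  have idx: "idx d (sys N) = idx (ex_dim N True) (sys N)"
    unfolding idx_def by (rule PiE_cong) (auto simp: sys_def d)
  define i where "i = (\<lambda>x\<in>sys N. 0 :: nat)"
  define k where "k = (\<lambda>x\<in>sys N. if x = SI 1 \<or> x = SI N then 1 else 0 :: nat)"
  have i: "i \<in> idx d (sys N)" by (auto simp: i_def idx ex_dim_pos)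
  have k: "k \<in> idx d (sys N)" by (auto simp: k_def idx ex_dim_pos) (auto simp: ex_dim_def)
  have iv: "i (SI 1) = 0" "i (SI N) = 0" "i (SO 1) = 0" "i (SO (N - 1)) = 0"
    and kv: "k (SI 1) = 1" "k (SI N) = 1" "k (SO 1) = 0" "k (SO (N - 1)) = 0"
    using N by (auto simp: i_def k_def)
  have "ex_process N True (i(SI 1 := k (SI 1))) (i(SI 1 := k (SI 1))) = 0"
    using iv kv N by (simp add: ex_process_def ex_out_def ex_bit_def)
  then have "ex_process N True i k = 0"
    using product_gram_zero[OF g i k] N by simp
  then show False using i k iv kv N by (simp add: ex_process_def ex_out_def ex_bit_def idx ex_dim_def)
qed

theorem mainTheorem3:
  fixes N :: nat
  assumes "N \<ge> 3"
  shows "\<not> CM N \<subseteq> NS N \<and> \<not> SEP N \<subseteq> NS N \<and> \<not> NS N \<subseteq> SEP N \<and> \<not> NS N \<subseteq> CM N"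
proof -
  let ?E = "(ex_dim N True, ex_process N True)"
  have NS: "?E \<in> NS N"
    by (rule trivial_outputs_NS[OF ex_process_QM[OF assms]]) (auto simp: ex_dim_def)
  have "?E \<notin> SEP N"
    using separable_gram[of "ex_dim N True" "ex_process N True" N] ex_process_not_product_gram[OF assms] assms
    by auto
  moreover have "?E \<notin> CM N"
  proof
    assume "?E \<in> CM N"
    then obtain d X where d: "env_choice (ex_dim N True) d" and p: "process_form N d X (ex_process N True)"
      and X: "\<And>j. j \<in> {1..<N} \<Longrightarrow> entanglement_breaking_choi d (EI j) (EO j) (X j)"
      unfolding CM_def by blast
    have "gram d (sys N) (product_at d (sys N) (SI 1)) (ex_process N True)"
      by (rule classical_memory_gram[OF _ p X]) (use assms in auto)
    then show False using ex_process_not_product_gram[OF assms] d by (auto simp: env_choice_def)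
  qed
  ultimately show ?thesis
    using NS ex_process_CM[OF assms] ex_process_SEP[OF assms] ex_process_not_NS[OF assms] by blast
qed

end
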